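(* Let $G$ be a finite simple graph that has a minimal completion set $\{v_1,\dots,v_k\}$ such that for each $1\le i\le k$ there exists $u_i\in\mathcal N_G(v_i)$ with $u_i\notin \bigcup_{j\ne i,\,1\le j\le k}\mathcal N_G[v_j]$. Then $\mathrm{v}_\emptyset(J_G)\le k\le \mathrm{reg}(S/J_G)$.
   Context: Let $K$ be a field and $G$ a finite simple graph on $V(G)=[n]$. Put $S=K[x_1,\dots,x_n,y_1,\dots,y_n]$ (standard grading), $f_{ij}=x_iy_j-x_jy_i$, and let $J_G=\langle f_{ij}\mid \{i,j\}\in E(G), i<j\rangle$ be the binomial edge ideal. $\mathrm{reg}$ denotes Castelnuovo–Mumford regularity. $P_\emptyset(G)$ is the ideal of $S$ generated by all $f_{ij}$ with $i<j$ in the same connected component of $G$; it is an associated prime of $J_G$. Define $\mathrm{v}_\emptyset(J_G)=\min\{d\ge 0\mid \exists f\in S_d\text{ with }(J_G:f)=P_\emptyset(G)\}$. For $v\in V(G)$, $\mathcal N_G(v)$ is its set of neighbours, $\mathcal N_G[v]=\mathcal N_G(v)\cup\{v\}$, and $G_v$ is the graph with $V(G_v)=V(G)$ and $E(G_v)=E(G)\cup\{\{i,j\}\mid i,j\in \mathcal N_G(v), i\ne j\}$. For $V=\{v_1,\dots,v_k\}\subseteq V(G)$, let $G_V=(\cdots((G_{v_1})_{v_2})\cdots)_{v_k}$ (independent of the ordering; $G_\emptyset=G$). $W\subseteq V(G)$ is a completion set of $G$ if $G_W$ is a disjoint union of complete graphs; it is a minimal completion set if moreover no proper subset of $W$ is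 a completion set. *)

theory Defs
  imports "HOL-Library.Poly_Mapping" "HOL-Library.Extended_Real"
begin

section \<open>Polynomial rings and ideals\<close>

text \<open>Polynomials over \<open>'k\<close> in the variables \<open>'v\<close>; monomials are exponent vectors.\<close>

type_synonym ('v, 'k) mpoly = "('v \<Rightarrow>\<^sub>0 nat) \<Rightarrow>\<^sub>0 'k"

definition var :: "'v \<Rightarrow> ('v, 'k::field) mpoly" where
  "var v = Poly_Mapping.single (Poly_Mapping.single v 1) 1"

definition homogeneous :: "nat \<Rightarrow> ('v::finite, 'k::field) mpoly set" where
  "homogeneous d = {p. \<forall>m\<in>Poly_Mapping.keys p. (\<Sum>v\<in>UNIV. Poly_Mapping.lookup m v) = d}"

text \<open>An ideal is a submodule of the ring over itself.\<close>

definition ideal_span :: "'a::comm_ring_1 set \<Rightarrow> 'a set" where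
  "ideal_span A = module.span (*) A"

definition colon :: "'a::comm_ring_1 set \<Rightarrow> 'a \<Rightarrow> 'a set" where
  "colon I f = {g. g * f \<in> I}"

text \<open>The infimum is taken in \<open>enat\<close>, so that it is \<open>\<infinity>\<close>, and not some natural number,
  if no \<open>f\<close> exists.\<close>

definition local_v_number ::
    "('v::finite, 'k::field) mpoly set \<Rightarrow> ('v, 'k) mpoly set \<Rightarrow> enat" where
  "local_v_number I P = (INF d \<in> {d. \<exists>f \<in> homogeneous d. colon I f = P}. enat d)"


section \<open>Graded free resolutions and regularity\<close>

text \<open>The free module with basis \<open>e\<^sub>b\<close>, \<open>b \<in> B\<close>, consists of the finitely supported families
  with support in \<open>B\<close>. If \<open>e\<^sub>b\<close> has degree \<open>d b\<close>, this is the direct sum of the shifts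
  \<open>S(- d b)\<close>.\<close>

definition free_mod :: "nat set \<Rightarrow> (nat \<Rightarrow>\<^sub>0 ('v, 'k::field) mpoly) set" where
  "free_mod B = {m. Poly_Mapping.keys m \<subseteq> B}"

definition free_mod_homogeneous ::
    "nat set \<Rightarrow> (nat \<Rightarrow> nat) \<Rightarrow> nat \<Rightarrow> (nat \<Rightarrow>\<^sub>0 ('v::finite, 'k::field) mpoly) set" where
  "free_mod_homogeneous B d D =
     {m \<in> free_mod B. \<forall>b\<in>Poly_Mapping.keys m.
        d b \<le> D \<and> Poly_Mapping.lookup m b \<in> homogeneous (D - d b)}"

text \<open>The linear map sending \<open>e\<^sub>b\<close> to \<open>\<phi> b\<close>.\<close>

definition lin_ext :: "(nat \<Rightarrow> nat \<Rightarrow>\<^sub>0 ('v, 'k::field) mpoly) \<Rightarrow>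
    (nat \<Rightarrow>\<^sub>0 ('v, 'k) mpoly) \<Rightarrow> (nat \<Rightarrow>\<^sub>0 ('v, 'k) mpoly)" where
  "lin_ext \<phi> m = (\<Sum>b\<in>Poly_Mapping.keys m.
     Poly_Mapping.map (\<lambda>q. Poly_Mapping.lookup m b * q) (\<phi> b))"

text \<open>A minimal graded free resolution
  \<open>\<dots> \<longrightarrow> F\<^sub>2 \<longrightarrow> F\<^sub>1 \<longrightarrow> F\<^sub>0 = S \<longrightarrow> S/I \<longrightarrow> 0\<close>.
  The basis of \<open>F\<^sub>i\<close> is \<open>B i\<close>, with degrees \<open>d i\<close>, and \<open>\<phi> i\<close> gives the map from \<open>F\<^sub>i\<^sub>+\<^sub>1\<close> to
  \<open>F\<^sub>i\<close>. The last clause is minimality: the image of \<open>F\<^sub>i\<^sub>+\<^sub>1\<close> lies in \<open>\<mm> F\<^sub>i\<close>, where \<open>\<mm>\<close> is the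
  ideal of the variables, that is, of the polynomials without constant term. Taking
  \<open>F\<^sub>0 = S\<close> is no restriction for proper \<open>I\<close>; for \<open>I = S\<close> there is no such resolution.
  The sets \<open>B i\<close> need not be assumed finite: as \<open>S\<close> is Noetherian, this follows from
  minimality.\<close>

definition minimal_graded_free_resolution ::
    "('v::finite, 'k::field) mpoly set \<Rightarrow> (nat \<Rightarrow> nat set) \<Rightarrow> (nat \<Rightarrow> nat \<Rightarrow> nat) \<Rightarrow>
     (nat \<Rightarrow> nat \<Rightarrow> nat \<Rightarrow>\<^sub>0 ('v, 'k) mpoly) \<Rightarrow> bool" where
  "minimal_graded_free_resolution I B d \<phi> \<longleftrightarrow>
     B 0 = {0} \<and> d 0 0 = 0 \<and>
     (\<forall>i. \<forall>b\<in>B (Suc i). \<phi> i b \<in> free_mod_homogeneous (B i) (d i) (d (Suc i) b)) \<and>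
     lin_ext (\<phi> 0) ` free_mod (B 1) = {m \<in> free_mod (B 0). Poly_Mapping.lookup m 0 \<in> I} \<and>
     (\<forall>i. lin_ext (\<phi> (Suc i)) ` free_mod (B (Suc (Suc i))) =
          {m \<in> free_mod (B (Suc i)). lin_ext (\<phi> i) m = 0}) \<and>
     (\<forall>i. \<forall>b\<in>B (Suc i). \<forall>c. Poly_Mapping.lookup (Poly_Mapping.lookup (\<phi> i b) c) 0 = 0)"

text \<open>The Castelnuovo--Mumford regularity of \<open>S/I\<close>, for a homogeneous ideal \<open>I\<close>: the largest
  \<open>j - i\<close> such that the minimal graded free resolution of \<open>S/I\<close>, which is unique up to
  isomorphism, has a generator of degree \<open>j\<close> in \<open>F\<^sub>i\<close> (the graded Betti number
  \<open>\<beta>\<^sub>i\<^sub>,\<^sub>j\<close> is nonzero). The zero module has regularity \<open>-\<infinity>\<close>.\<close>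

definition regularity_quotient :: "('v::finite, 'k::field) mpoly set \<Rightarrow> ereal" where
  "regularity_quotient I =
     Sup {ereal (real j - real i) | i j.
       \<exists>B d \<phi>. minimal_graded_free_resolution I B d \<phi> \<and> (\<exists>b \<in> B i. d i b = j)}"


section \<open>Graphs and completion sets\<close>

text \<open>The vertex set is the whole finite, linearly ordered type \<open>'n\<close>, in the role of
  \<open>{1, \<dots>, n}\<close>; a graph is given by its set of edges.\<close>

definition simple_graph :: "'n set set \<Rightarrow> bool" where
  "simple_graph E \<longleftrightarrow> (\<forall>e\<in>E. card e = 2)"

definition nbrs :: "'n set set \<Rightarrow> 'n \<Rightarrow> 'n set" where
  "nbrs E v = {w. {v, w} \<in> E}"

definition closed_nbrs :: "'n set set \<Rightarrow> 'n \<Rightarrow> 'n set" where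
  "closed_nbrs E v = insert v (nbrs E v)"

definition same_component :: "'n set set \<Rightarrow> 'n \<Rightarrow> 'n \<Rightarrow> bool" where
  "same_component E i j \<longleftrightarrow> (i, j) \<in> {(a, b). {a, b} \<in> E}\<^sup>*"

definition complete_at :: "'n \<Rightarrow> 'n set set \<Rightarrow> 'n set set" where
  "complete_at v E = E \<union> {{i, j} | i j. i \<in> nbrs E v \<and> j \<in> nbrs E v \<and> i \<noteq> j}"

text \<open>The vertices are processed in increasing order; by \<open>complete_at_commute\<close> below any
  other order gives the same graph.\<close>

definition complete_on :: "'n::{finite,linorder} set \<Rightarrow> 'n set set \<Rightarrow> 'n set set" where
  "complete_on W E = fold complete_at (sorted_list_of_set W) E"

definition disjoint_union_of_complete :: "'n set set \<Rightarrow> bool" where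
  "disjoint_union_of_complete E \<longleftrightarrow> (\<forall>i j. same_component E i j \<and> i \<noteq> j \<longrightarrow> {i, j} \<in> E)"

definition completion_set :: "'n::{finite,linorder} set set \<Rightarrow> 'n set \<Rightarrow> bool" where
  "completion_set E W \<longleftrightarrow> disjoint_union_of_complete (complete_on W E)"

definition minimal_completion_set :: "'n::{finite,linorder} set set \<Rightarrow> 'n set \<Rightarrow> bool" where
  "minimal_completion_set E W \<longleftrightarrow>
     completion_set E W \<and> (\<forall>W'. W' \<subset> W \<longrightarrow> \<not> completion_set E W')"

lemma nbrs_complete_at:
  "w \<in> nbrs (complete_at v E) u \<longleftrightarrow>
     w \<in> nbrs E u \<or> u \<in> nbrs E v \<and> w \<in> nbrs E v \<and> u \<noteq> w"
  by (auto simp: nbrs_def complete_at_def doubleton_eq_iff)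

lemma simple_graph_complete_at: "simple_graph E \<Longrightarrow> simple_graph (complete_at v E)"
  by (auto simp: simple_graph_def complete_at_def)

lemma simple_graph_eqI:
  assumes "simple_graph E" "simple_graph F" "\<And>u. nbrs E u = nbrs F u"
  shows "E = F"
proof -
  have "{a, b} \<in> E \<longleftrightarrow> {a, b} \<in> F" for a b
    using assms(3)[of a] by (auto simp: nbrs_def)
  with assms(1,2) show ?thesis
    unfolding simple_graph_def by (metis card_2_iff subsetI subset_antisym)
qed

lemma complete_at_commute:
  assumes "simple_graph E"
  shows "complete_at v (complete_at w E) = complete_at w (complete_at v E)"
proof (rule simple_graph_eqI)
  have sym: "a \<in> nbrs E b \<longleftrightarrow> b \<in> nbrs E a" for a b
    by (auto simp: nbrs_def insert_commute)
  have irr: "a \<notin> nbrs E a" for a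
    using assms by (auto simp: nbrs_def simple_graph_def)
  show "nbrs (complete_at v (complete_at w E)) u = nbrs (complete_at w (complete_at v E)) u" for u
    unfolding set_eq_iff nbrs_complete_at using sym irr by metis
qed (simp_all add: assms simple_graph_complete_at)


section \<open>Binomial edge ideals\<close>

text \<open>The variables are indexed by \<open>'n + 'n\<close>: \<open>Inl i\<close> stands for \<open>x\<^sub>i\<close> and \<open>Inr i\<close> for
  \<open>y\<^sub>i\<close>.\<close>

definition edge_binomial :: "'n \<Rightarrow> 'n \<Rightarrow> ('n + 'n, 'k::field) mpoly" where
  "edge_binomial i j = var (Inl i) * var (Inr j) - var (Inl j) * var (Inr i)"

definition binomial_edge_ideal ::
    "'n::{finite,linorder} set set \<Rightarrow> ('n + 'n, 'k::field) mpoly set" where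
  "binomial_edge_ideal E = ideal_span {edge_binomial i j | i j. {i, j} \<in> E \<and> i < j}"

definition P_empty :: "'n::{finite,linorder} set set \<Rightarrow> ('n + 'n, 'k::field) mpoly set" where
  "P_empty E = ideal_span {edge_binomial i j | i j. same_component E i j \<and> i < j}"

end

theory Submission
  imports Defs "HOL-Library.Function_Algebras" "HOL-Library.FuncSet"
begin

text \<open>
  Write \<open>J\<close> for the binomial edge ideal and \<open>W = {v\<^sub>1, \<dots>, v\<^sub>k}\<close> for the completion set. The two
  inequalities have independent proofs.

  \<^bold>\<open>Upper bound on the local v-number.\<close> The witness is \<open>f = x\<^bsub>v\<^sub>1\<^esub> \<cdots> x\<^bsub>v\<^sub>k\<^esub>\<close>. The identity
  \<open>x\<^sub>v f\<^sub>i\<^sub>j = x\<^sub>i f\<^sub>v\<^sub>j - x\<^sub>j f\<^sub>v\<^sub>i\<close> shows that multiplication by \<open>x\<^sub>v\<close> maps the ideal of the graph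
  completed at \<open>v\<close> into the ideal of the graph itself. Completing at all of \<open>W\<close> gives disjoint
  complete graphs, whose ideal contains \<open>P\<^sub>\<emptyset>\<close>, so \<open>f P\<^sub>\<emptyset> \<subseteq> J\<close>. Conversely \<open>J \<subseteq> P\<^sub>\<emptyset>\<close>, and
  monomials are nonzerodivisors modulo \<open>P\<^sub>\<emptyset>\<close>, because \<open>P\<^sub>\<emptyset>\<close> is a toric ideal: it is the kernel of
  a linear map that sends each monomial to its degree in a finer grading
  (\<open>P_empty_eq_kernel\<close>). Hence \<open>J : f = P\<^sub>\<emptyset>\<close>.

  \<^bold>\<open>Lower bound on the regularity.\<close> The idea is that the \<open>k\<close> binomials \<open>f\<^bsub>v\<^sub>iu\<^sub>i\<^esub>\<close> survive as a
  product in \<open>Tor\<^sub>k(S/J, K)\<close>. Kill all variables except \<open>x\<^bsub>v\<^sub>i\<^esub>\<close> and \<open>y\<^bsub>u\<^sub>i\<^esub>\<close>. As the only edges from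
  some \<open>v\<^sub>i\<close> to some \<open>u\<^sub>j\<close> are the \<open>{v\<^sub>i, u\<^sub>i}\<close>, the ideal \<open>J\<close> becomes the complete
  intersection generated by the monomials \<open>x\<^bsub>v\<^sub>i\<^esub> y\<^bsub>u\<^sub>i\<^esub>\<close>. So the Koszul complex of the \<open>f\<^bsub>v\<^sub>iu\<^sub>i\<^esub>\<close> maps to the
  minimal resolution \<open>F\<close> of \<open>S/J\<close>, which in turn maps to the Koszul complex of the monomials, and
  the composite is the identity modulo the variables. Its top element, in homological degree \<open>k\<close> and
  internal degree \<open>2k\<close>, therefore gives a generator of \<open>F\<^sub>k\<close> of degree \<open>2k\<close>.

  This is carried out without exterior algebra (\<open>resolution_has_generator\<close>). The image of the top
  Koszul element is obtained by applying successively \<open>k\<close> homotopies \<open>\<sigma>\<close>, one for the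
  multiplication by each \<open>f\<^bsub>v\<^sub>iu\<^sub>i\<^esub>\<close>. Instead of the map to the second Koszul complex there is a
  sequence of linear maps \<open>F\<^sub>i \<rightarrow> S\<close>, each obtained from the previous one by composing with the
  differential and dividing by one of the monomials; they represent iterated connecting
  homomorphisms \<open>Ext\<^sup>i(S/J, N/zN) \<rightarrow> Ext\<^sup>i\<^sup>+\<^sup>1(S/J, N)\<close>.

  The regularity is a supremum over minimal graded free resolutions, so one must exist. It is built
  one homological degree at a time: in a graded submodule \<open>M\<close> of a free module, a basis over the field of
  \<open>\<mm>M\<close> that consists of homogeneous elements is extended to such a basis of \<open>M\<close>, and the
  added elements are minimal generators (\<open>minimal_homogeneous_generators\<close>).
\<close>

section \<open>Monomials, degrees and ideals\<close>

abbreviation lookup :: "('a \<Rightarrow>\<^sub>0 'b::zero) \<Rightarrow> 'a \<Rightarrow> 'b" where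
  "lookup \<equiv> Poly_Mapping.lookup"

abbreviation keys :: "('a \<Rightarrow>\<^sub>0 'b::zero) \<Rightarrow> 'a set" where
  "keys \<equiv> Poly_Mapping.keys"

abbreviation single :: "'a \<Rightarrow> 'b::zero \<Rightarrow> 'a \<Rightarrow>\<^sub>0 'b" where
  "single \<equiv> Poly_Mapping.single"

lemma poly_mapping_sum_monomials: "(\<Sum>m\<in>keys p. single m (lookup p m)) = p"
  by (rule poly_mapping_eqI) (auto simp: lookup_sum lookup_single when_def in_keys_iff)

lemma keys_sum_subset: "keys (sum h X) \<subseteq> (\<Union>x\<in>X. keys (h x))"
proof
  fix m assume "m \<in> keys (sum h X)"
  then have "(\<Sum>x\<in>X. lookup (h x) m) \<noteq> 0" by (simp add: in_keys_iff lookup_sum)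
  then have "\<exists>x\<in>X. lookup (h x) m \<noteq> 0" by (rule contrapos_np) (simp add: sum.neutral)
  then show "m \<in> (\<Union>x\<in>X. keys (h x))" by (auto simp: in_keys_iff)
qed

lemma lookup_monomial_times:
  fixes s t :: "'a::cancel_comm_monoid_add"
  shows "lookup (single s c * q) (s + t) = c * lookup q (t :: 'a) "
  by (simp add: lookup_mult lookup_single when_mult)

lemma keys_monomial_times:
  fixes s :: "'a::cancel_comm_monoid_add"
  shows "keys (single s 1 * q) = (+) s ` keys (q :: 'a \<Rightarrow>\<^sub>0 'k::field)"
proof
  show "keys (single s 1 * q) \<subseteq> (+) s ` keys q"
    using keys_mult[of "single s 1" q] by auto
  show "(+) s ` keys q \<subseteq> keys (single s 1 * q)"
    by (auto simp: in_keys_iff lookup_monomial_times)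
qed

lemma lookup_times_zero:
  fixes p q :: "('v, 'k::field) mpoly"
  shows "lookup (p * q) 0 = lookup p 0 * lookup q 0"
proof -
  have "lookup (p * q) 0 = (\<Sum>l. lookup p l * (\<Sum>m. lookup q m when 0 = l + m))"
    by (simp add: lookup_mult)
  also have "(\<lambda>l. lookup p l * (\<Sum>m. lookup q m when 0 = l + m)) = (\<lambda>l. lookup p 0 * lookup q 0 when l = 0)"
  proof
    fix l :: "'v \<Rightarrow>\<^sub>0 nat"
    have "(0 = l + m) = (l = 0 \<and> m = 0)" for m :: "'v \<Rightarrow>\<^sub>0 nat"
      by (metis add.right_neutral add_eq_0_iff_both_eq_0 lookup_add lookup_zero poly_mapping_eqI)
    then show "lookup p l * (\<Sum>m. lookup q m when 0 = l + m) = (lookup p 0 * lookup q 0 when l = 0)"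
      by (cases "l = 0") (simp_all)
  qed
  finally show ?thesis by simp
qed

abbreviation total_degree :: "('v::finite \<Rightarrow>\<^sub>0 nat) \<Rightarrow> nat" where
  "total_degree m \<equiv> \<Sum>v\<in>UNIV. lookup m v"

lemma total_degree_add: "total_degree (m + m') = total_degree m + total_degree m'"
  by (simp add: lookup_add sum.distrib)

lemma total_degree_single [simp]: "total_degree (single v c) = c"
  by (simp add: lookup_single when_def)

lemma homogeneousD: "p \<in> homogeneous d \<Longrightarrow> m \<in> keys p \<Longrightarrow> total_degree m = d"
  by (simp add: homogeneous_def)

lemma homogeneous_add: "p \<in> homogeneous d \<Longrightarrow> q \<in> homogeneous d \<Longrightarrow> p + q \<in> homogeneous d"
  using keys_add[of p q] by (auto simp: homogeneous_def)

lemma homogeneous_times: "p \<in> homogeneous d \<Longrightarrow> q \<in> homogeneous e \<Longrightarrow> p * q \<in> homogeneous (d + e)"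
  using keys_mult[of p q] by (fastforce simp: homogeneous_def total_degree_add simp del: sum.distrib)

lemma homogeneous_monomial: "single m c \<in> homogeneous (total_degree m)"
  by (simp add: homogeneous_def)

lemma homogeneous_uminus: "p \<in> homogeneous d \<Longrightarrow> - p \<in> homogeneous d"
  by (simp add: homogeneous_def in_keys_iff)

lemma var_homogeneous: "var v \<in> homogeneous 1"
  using homogeneous_monomial[of "single v 1" 1] by (simp add: var_def)

lemma edge_binomial_homogeneous:
  "(edge_binomial i j :: ('n::finite + 'n, 'k::field) mpoly) \<in> homogeneous 2"
proof -
  have "var a * var b \<in> (homogeneous 2 :: ('n + 'n, 'k) mpoly set)" for a b
    using homogeneous_times[OF var_homogeneous var_homogeneous, of a b] by (simp add: numeral_2_eq_2)
  from homogeneous_add[OF this homogeneous_uminus[OF this]] show ?thesis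
    by (simp add: edge_binomial_def)
qed

lemma module_times: "module ((*) :: 'a::comm_ring_1 \<Rightarrow> 'a \<Rightarrow> 'a)"
  by standard (simp_all add: algebra_simps)

lemma ideal_span_0: "0 \<in> ideal_span A"
  by (simp add: ideal_span_def module.span_zero[OF module_times])

lemma ideal_span_base: "a \<in> A \<Longrightarrow> a \<in> ideal_span A"
  by (simp add: ideal_span_def module.span_base[OF module_times])

lemma ideal_span_add: "a \<in> ideal_span A \<Longrightarrow> b \<in> ideal_span A \<Longrightarrow> a + b \<in> ideal_span A"
  by (simp add: ideal_span_def module.span_add[OF module_times])

lemma ideal_span_diff: "a \<in> ideal_span A \<Longrightarrow> b \<in> ideal_span A \<Longrightarrow> a - b \<in> ideal_span A"
  by (simp add: ideal_span_def module.span_diff[OF module_times])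

lemma ideal_span_uminus: "a \<in> ideal_span A \<Longrightarrow> - a \<in> ideal_span A"
  by (simp add: ideal_span_def module.span_neg[OF module_times])

lemma ideal_span_times: "a \<in> ideal_span A \<Longrightarrow> c * a \<in> ideal_span A"
  by (simp add: ideal_span_def module.span_scale[OF module_times])

lemma ideal_span_sum: "(\<And>x. x \<in> X \<Longrightarrow> f x \<in> ideal_span A) \<Longrightarrow> sum f X \<in> ideal_span A"
  by (simp add: ideal_span_def module.span_sum[OF module_times])

lemma ideal_span_induct [consumes 1, case_names zero add]:
  assumes "x \<in> ideal_span A" and "P 0"
    and "\<And>c a y. a \<in> A \<Longrightarrow> P y \<Longrightarrow> P (c * a + y)"
  shows "P x"
  using module.span_induct_alt[OF module_times, of x A P] assms by (simp add: ideal_span_def)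


section \<open>Linear maps induced by maps of monomials\<close>

definition pushforward :: "('a \<Rightarrow> 'b) \<Rightarrow> ('a \<Rightarrow>\<^sub>0 'k::comm_ring_1) \<Rightarrow> ('b \<Rightarrow>\<^sub>0 'k)" where
  "pushforward h p = (\<Sum>m\<in>keys p. single (h m) (lookup p m))"

lemma pushforward_superset:
  "finite A \<Longrightarrow> keys p \<subseteq> A \<Longrightarrow> pushforward h p = (\<Sum>m\<in>A. single (h m) (lookup p m))"
  unfolding pushforward_def by (rule sum.mono_neutral_left) (auto simp: in_keys_iff)

lemma pushforward_add: "pushforward h (p + q) = pushforward h p + pushforward h q"
proof -
  let ?A = "keys p \<union> keys q"
  have "pushforward h (p + q) = (\<Sum>m\<in>?A. single (h m) (lookup (p + q) m))"
    using keys_add[of p q] by (intro pushforward_superset) auto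
  also have "\<dots> = (\<Sum>m\<in>?A. single (h m) (lookup p m)) + (\<Sum>m\<in>?A. single (h m) (lookup q m))"
    by (simp add: lookup_add single_add sum.distrib)
  also have "\<dots> = pushforward h p + pushforward h q"
    by (simp add: pushforward_superset[of ?A])
  finally show ?thesis .
qed

lemma pushforward_zero [simp]: "pushforward h 0 = 0"
  by (simp add: pushforward_def)

lemma pushforward_single [simp]: "pushforward h (single m c) = single (h m) c"
  by (simp add: pushforward_def)

lemma pushforward_sum: "pushforward h (sum f X) = (\<Sum>x\<in>X. pushforward h (f x))"
  by (induction X rule: infinite_finite_induct) (simp_all add: pushforward_add)

lemma pushforward_pushforward: "pushforward g (pushforward h p) = pushforward (g \<circ> h) p"
  by (simp add: pushforward_def[of h] pushforward_sum) (simp add: pushforward_def)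

lemma pushforward_times:
  fixes h :: "'a::comm_monoid_add \<Rightarrow> 'b::comm_monoid_add" and p q :: "'a \<Rightarrow>\<^sub>0 'k::comm_ring_1"
  assumes h: "\<And>m m'. h (m + m') = h m + h m'"
  shows "pushforward h (p * q) = pushforward h p * pushforward h q"
proof -
  have "p * q = (\<Sum>m\<in>keys p. \<Sum>m'\<in>keys q. single (m + m') (lookup p m * lookup q m'))"
    by (subst (1) poly_mapping_sum_monomials[of p, symmetric],
        subst (1) poly_mapping_sum_monomials[of q, symmetric]) (simp add: sum_product mult_single)
  then have "pushforward h (p * q)
      = (\<Sum>m\<in>keys p. \<Sum>m'\<in>keys q. single (h m + h m') (lookup p m * lookup q m'))"
    by (simp add: pushforward_sum h)
  then show ?thesis
    by (simp add: pushforward_def sum_product mult_single)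
qed


section \<open>The ideal of a disjoint union of complete graphs is a toric ideal\<close>

lemma edge_binomial_swap: "edge_binomial j i = - edge_binomial i j"
  by (simp add: edge_binomial_def)

lemma edge_binomial_self: "edge_binomial i i = 0"
  by (simp add: edge_binomial_def)

lemma edge_binomial_mem:
  fixes R :: "'n::linorder \<Rightarrow> 'n \<Rightarrow> bool"
  assumes "R i j" "R j i"
  shows "edge_binomial i j \<in> ideal_span {edge_binomial i j | i j. R i j \<and> i < j}"
proof (cases i j rule: linorder_cases)
  case less then show ?thesis using assms by (blast intro: ideal_span_base)
next
  case equal then show ?thesis by (simp add: edge_binomial_self ideal_span_0)
next
  case greater
  then have "edge_binomial j i \<in> ideal_span {edge_binomial i j | i j. R i j \<and> i < j}"
    using assms by (blast intro: ideal_span_base)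
  then show ?thesis by (subst edge_binomial_swap) (rule ideal_span_uminus)
qed

lemma same_component_refl: "same_component E i i"
  by (simp add: same_component_def)

lemma same_component_sym: "same_component E i j \<Longrightarrow> same_component E j i"
  unfolding same_component_def
  by (rule symD[OF sym_rtrancl]) (auto intro: symI simp: insert_commute)

lemma same_component_trans:
  "same_component E i j \<Longrightarrow> same_component E j l \<Longrightarrow> same_component E i l"
  unfolding same_component_def by (rule rtrancl_trans)

lemma edge_binomial_in_P_empty:
  "same_component E i j \<Longrightarrow> edge_binomial i j \<in> P_empty E"
  unfolding P_empty_def by (rule edge_binomial_mem) (auto intro: same_component_sym)

lemma edge_binomial_in_binomial_edge_ideal:
  "{i, j} \<in> E \<Longrightarrow> edge_binomial i j \<in> binomial_edge_ideal E"
  unfolding binomial_edge_ideal_def by (rule edge_binomial_mem) (auto simp: insert_commute)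

text \<open>The exponent of the monomial to which \<open>m\<close> is sent under \<open>x\<^sub>i \<mapsto> t\<^sub>i s\<^sub>C\<close>, \<open>y\<^sub>i \<mapsto> t\<^sub>i\<close>, where \<open>C\<close> is the
  component of \<open>i\<close>: the exponent of \<open>t\<^sub>i\<close> is at \<open>Inl i\<close>, and that of \<open>s\<^sub>C\<close> is repeated at \<open>Inr i\<close> for
  every \<open>i \<in> C\<close>.\<close>

definition toric_degree :: "'n::finite set set \<Rightarrow> ('n + 'n \<Rightarrow>\<^sub>0 nat) \<Rightarrow> 'n + 'n \<Rightarrow> nat" where
  "toric_degree E m = case_sum (\<lambda>i. lookup m (Inl i) + lookup m (Inr i))
     (\<lambda>i. \<Sum>j | same_component E i j. lookup m (Inl j))"

lemma toric_degree_add: "toric_degree E (m + m') = toric_degree E m + toric_degree E m'"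
  by (auto simp: toric_degree_def fun_eq_iff lookup_add sum.distrib split: sum.split)

lemma toric_degree_exchange:
  assumes "same_component E i j"
  shows "toric_degree E (single (Inl i) 1 + single (Inr j) 1)
       = toric_degree E (single (Inl j) 1 + single (Inr i) 1)"
  using same_component_trans[OF _ assms] same_component_trans[OF _ same_component_sym[OF assms]]
  by (auto simp: toric_degree_def fun_eq_iff lookup_add lookup_single when_def sum.distrib
      split: sum.split)

lemma var_times_var:
  "var a * var b = (single (single a 1 + single b 1) 1 :: ('v, 'k::field) mpoly)"
  by (simp add: var_def mult_single)

lemma edge_binomial_monomials:
  "(edge_binomial i j :: ('n + 'n, 'k::field) mpoly) =
     single (single (Inl i) 1 + single (Inr j) 1) 1 - single (single (Inl j) 1 + single (Inr i) 1) 1"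
  by (simp add: edge_binomial_def var_times_var)

text \<open>Two monomials of equal toric degree are linked by exchanges \<open>x\<^sub>i y\<^sub>j \<rightarrow> x\<^sub>j y\<^sub>i\<close> inside components.
  If they differ, then some \<open>x\<^sub>i\<close> has a larger exponent in \<open>m\<close> than in \<open>m'\<close>, and as the
  \<open>x\<close>-degrees in the component agree, some \<open>x\<^sub>j\<close> of the component has a smaller one; the total degree
  at \<open>j\<close> then forces \<open>y\<^sub>j\<close> to divide \<open>m\<close>. The exchange reduces the total excess of \<open>m\<close> over
  \<open>m'\<close> in the \<open>x\<close>-exponents.\<close>

lemma monomial_diff_in_P_empty:
  fixes E :: "'n::{finite,linorder} set set"
  assumes "toric_degree E m = toric_degree E m'"
  shows "(single m 1 - single m' 1 :: ('n + 'n, 'k::field) mpoly) \<in> P_empty E"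
  using assms
proof (induction "\<Sum>i\<in>UNIV. lookup m (Inl i) - lookup m' (Inl i)" arbitrary: m rule: less_induct)
  case less
  have tot: "lookup m (Inl i) + lookup m (Inr i) = lookup m' (Inl i) + lookup m' (Inr i)" for i
    using fun_cong[OF less.prems, of "Inl i"] by (simp add: toric_degree_def)
  have comp: "(\<Sum>j | same_component E i j. lookup m (Inl j))
      = (\<Sum>j | same_component E i j. lookup m' (Inl j))" for i
    using fun_cong[OF less.prems, of "Inr i"] by (simp add: toric_degree_def)
  show ?case
  proof (cases "m = m'")
    case True then show ?thesis by (simp add: P_empty_def ideal_span_0)
  next
    case False
    have "\<exists>i. lookup m (Inl i) > lookup m' (Inl i)"
    proof (rule ccontr)
      assume "\<not> ?thesis"
      then have le: "lookup m (Inl j) \<le> lookup m' (Inl j)" for j by (simp add: not_less)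
      have eq: "lookup m (Inl i) = lookup m' (Inl i)" for i
      proof (rule ccontr)
        assume "lookup m (Inl i) \<noteq> lookup m' (Inl i)"
        then have "lookup m (Inl i) < lookup m' (Inl i)" using le[of i] by simp
        then have "(\<Sum>j | same_component E i j. lookup m (Inl j))
            < (\<Sum>j | same_component E i j. lookup m' (Inl j))"
          using le same_component_refl[of E i] by (intro sum_strict_mono_ex1) auto
        then show False using comp[of i] by simp
      qed
      have "lookup m (Inr i) = lookup m' (Inr i)" for i
        using eq[of i] tot[of i] by simp
      then have "lookup m k = lookup m' k" for k
        by (cases k) (simp_all add: eq)
      then have "m = m'" by (rule poly_mapping_eqI)
      then show False using False by simp
    qed
    then obtain i where i: "lookup m (Inl i) > lookup m' (Inl i)" ..
    have "\<exists>j. same_component E i j \<and> lookup m (Inl j) < lookup m' (Inl j)"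
    proof (rule ccontr)
      assume "\<not> ?thesis"
      then have "(\<Sum>j | same_component E i j. lookup m' (Inl j))
          < (\<Sum>j | same_component E i j. lookup m (Inl j))"
        using i same_component_refl[of E i] by (intro sum_strict_mono_ex1) (auto simp: not_less)
      then show False using comp[of i] by simp
    qed
    then obtain j where j: "same_component E i j" "lookup m (Inl j) < lookup m' (Inl j)" by blast
    have ij: "i \<noteq> j" using i j by auto
    have yj: "lookup m (Inr j) > 0" using tot[of j] j(2) by simp
    \<comment> \<open>\<open>m2\<close> is \<open>m\<close> after the exchange, and \<open>r\<close> the common cofactor.\<close>
    define r where "r = m - (single (Inl i) 1 + single (Inr j) 1)"
    define m2 where "m2 = r + (single (Inl j) 1 + single (Inr i) 1)"
    have m: "m = r + (single (Inl i) 1 + single (Inr j) 1)"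
      using i yj by (intro poly_mapping_eqI)
        (auto simp: r_def lookup_add lookup_minus lookup_single when_def)
    have "toric_degree E m2 = toric_degree E m'"
      using less.prems toric_degree_exchange[OF j(1)]
      by (simp only: m m2_def toric_degree_add[of E r])
    moreover have "(\<Sum>l\<in>UNIV. lookup m2 (Inl l) - lookup m' (Inl l))
        < (\<Sum>l\<in>UNIV. lookup m (Inl l) - lookup m' (Inl l))"
    proof (rule sum_strict_mono_ex1)
      show "\<forall>l\<in>UNIV. lookup m2 (Inl l) - lookup m' (Inl l) \<le> lookup m (Inl l) - lookup m' (Inl l)"
        using j(2) ij by (auto simp: m m2_def lookup_add lookup_single when_def)
      show "\<exists>l\<in>UNIV. lookup m2 (Inl l) - lookup m' (Inl l) < lookup m (Inl l) - lookup m' (Inl l)"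
        using i ij by (intro bexI[of _ i]) (auto simp: m m2_def lookup_add lookup_single when_def)
    qed simp
    ultimately have *: "(single m2 1 - single m' 1 :: ('n + 'n, 'k) mpoly) \<in> P_empty E"
      using less.hyps by blast
    have "(single m 1 - single m2 1 :: ('n + 'n, 'k) mpoly) = single r 1 * edge_binomial i j"
      by (simp add: m m2_def edge_binomial_monomials right_diff_distrib mult_single)
    also have "\<dots> \<in> P_empty E"
      using edge_binomial_in_P_empty[OF j(1)] unfolding P_empty_def by (rule ideal_span_times)
    finally have "(single m 1 - single m2 1) + (single m2 1 - single m' 1 :: ('n + 'n, 'k) mpoly)
        \<in> P_empty E"
      using * unfolding P_empty_def by (rule ideal_span_add)
    then show ?thesis by simp
  qed
qed

text \<open>The kernel of a monomial map consists of the polynomials whose coefficients sum to zero over each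
  set of monomials with the same image. Such a polynomial does not change modulo differences of
  monomials with the same image when every monomial is replaced by a chosen representative \<open>r\<close> of its
  fibre, and this replacement turns it into zero.\<close>

lemma P_empty_eq_kernel:
  fixes E :: "'n::{finite,linorder} set set"
  shows "P_empty E = {p :: ('n + 'n, 'k::field) mpoly. pushforward (toric_degree E) p = 0}"
proof (intro set_eqI iffI)
  fix p :: "('n + 'n, 'k) mpoly"
  assume "p \<in> P_empty E"
  then show "p \<in> {p. pushforward (toric_degree E) p = 0}"
    unfolding P_empty_def
  proof (induction rule: ideal_span_induct)
    case (add c a y)
    then obtain i j where a: "a = edge_binomial i j" "same_component E i j" by blast
    have "a + single (single (Inl j) 1 + single (Inr i) 1) 1
        = single (single (Inl i) 1 + single (Inr j) 1) 1"
      by (simp add: a edge_binomial_monomials)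
    from arg_cong[OF this, of "pushforward (toric_degree E)"]
    have "pushforward (toric_degree E) a = 0"
      using toric_degree_exchange[OF a(2)] by (simp add: pushforward_add)
    with add show ?case
      by (simp add: pushforward_add pushforward_times toric_degree_add)
  qed simp
next
  fix p :: "('n + 'n, 'k) mpoly"
  assume "p \<in> {p. pushforward (toric_degree E) p = 0}"
  then have 0: "pushforward (toric_degree E) p = 0" by simp
  define r where "r t = (SOME m. toric_degree E m = t)" for t
  have r: "toric_degree E (r (toric_degree E m)) = toric_degree E m" for m
    unfolding r_def by (rule someI_ex) blast
  have "pushforward (r \<circ> toric_degree E) p = 0"
    unfolding pushforward_pushforward[symmetric] 0 by simp
  then have "p = p - pushforward (r \<circ> toric_degree E) p" by simp
  also have "\<dots> = (\<Sum>m\<in>keys p. single m (lookup p m)) - pushforward (r \<circ> toric_degree E) p"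
    by (simp add: poly_mapping_sum_monomials)
  also have "\<dots> = (\<Sum>m\<in>keys p. single 0 (lookup p m) * (single m 1 - single (r (toric_degree E m)) 1))"
    by (simp add: pushforward_def right_diff_distrib mult_single sum_subtractf)
  also have "\<dots> \<in> P_empty E"
    using monomial_diff_in_P_empty[OF r[symmetric]] unfolding P_empty_def
    by (intro ideal_span_sum ideal_span_times)
  finally show "p \<in> P_empty E" .
qed

text \<open>The toric degree takes values in a cancellative monoid, so that a monomial acts
  injectively on the target of the map with kernel \<open>P\<^sub>\<emptyset>\<close>. Thus monomials are nonzerodivisors
  modulo \<open>P\<^sub>\<emptyset>\<close>, which bounds the colon ideal from above.\<close>

lemma P_empty_monomial_cancel:
  fixes E :: "'n::{finite,linorder} set set" and g :: "('n + 'n, 'k::field) mpoly"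
  assumes "single s 1 * g \<in> P_empty E"
  shows "g \<in> P_empty E"
proof -
  have "single (toric_degree E s) 1 * pushforward (toric_degree E) g = 0"
    using assms by (simp add: P_empty_eq_kernel pushforward_times toric_degree_add)
  from arg_cong[OF this, of keys] have "keys (pushforward (toric_degree E) g) = {}"
    by (simp add: keys_monomial_times)
  then have "pushforward (toric_degree E) g = 0"
    by (metis empty_iff lookup_zero not_in_keys_iff_lookup_eq_zero poly_mapping_eqI)
  then show ?thesis by (simp add: P_empty_eq_kernel)
qed


section \<open>The local v-number\<close>

text \<open>The new edges \<open>{i, j}\<close> join neighbours of \<open>v\<close>, where
  \<open>x\<^sub>v f\<^sub>i\<^sub>j = x\<^sub>i f\<^sub>v\<^sub>j - x\<^sub>j f\<^sub>v\<^sub>i\<close>.\<close>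

lemma var_times_complete_at:
  fixes E :: "'n::{finite,linorder} set set" and p :: "('n + 'n, 'k::field) mpoly"
  assumes "p \<in> binomial_edge_ideal (complete_at v E)"
  shows "var (Inl v) * p \<in> binomial_edge_ideal E"
  using assms unfolding binomial_edge_ideal_def[of "complete_at v E"]
proof (induction rule: ideal_span_induct)
  case zero show ?case by (simp add: binomial_edge_ideal_def ideal_span_0)
next
  case (add c a y)
  let ?x = "\<lambda>i. var (Inl i) :: ('n + 'n, 'k) mpoly"
  from add obtain i j where a: "a = edge_binomial i j" "{i, j} \<in> complete_at v E" by blast
  have "?x v * edge_binomial i j \<in> binomial_edge_ideal E"
  proof (cases "{i, j} \<in> E")
    case True
    then show ?thesis
      using edge_binomial_in_binomial_edge_ideal[OF True] ideal_span_times
      unfolding binomial_edge_ideal_def by blast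
  next
    case False
    with a have "{v, i} \<in> E" "{v, j} \<in> E"
      by (auto simp: complete_at_def nbrs_def doubleton_eq_iff)
    from this[THEN edge_binomial_in_binomial_edge_ideal]
    have "?x i * edge_binomial v j - ?x j * edge_binomial v i \<in> binomial_edge_ideal E"
      unfolding binomial_edge_ideal_def by (intro ideal_span_diff ideal_span_times)
    also have "?x i * edge_binomial v j - ?x j * edge_binomial v i = ?x v * edge_binomial i j"
      by (simp add: edge_binomial_def algebra_simps)
    finally show ?thesis .
  qed
  then have "c * (?x v * a) + ?x v * y \<in> binomial_edge_ideal E"
    using add.IH unfolding binomial_edge_ideal_def a(1)
    by (intro ideal_span_add) (auto intro: ideal_span_times)
  then show ?case by (simp add: algebra_simps)
qed

lemma prod_var_times_complete_on:
  fixes E :: "'n::{finite,linorder} set set" and p :: "('n + 'n, 'k::field) mpoly"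
  assumes "p \<in> binomial_edge_ideal (fold complete_at vs E)"
  shows "(\<Prod>v\<leftarrow>vs. var (Inl v)) * p \<in> binomial_edge_ideal E"
  using assms
proof (induction vs arbitrary: E)
  case (Cons v vs)
  then have "(\<Prod>v\<leftarrow>vs. var (Inl v)) * p \<in> binomial_edge_ideal (complete_at v E)" by simp
  then show ?case using var_times_complete_at by (simp add: mult.assoc)
qed simp

lemma prod_var_monomial:
  "(\<Prod>v\<leftarrow>vs. var (Inl v)) = (single (\<Sum>v\<leftarrow>vs. single (Inl v) 1) 1 :: ('n + 'n, 'k::field) mpoly)"
  by (induction vs) (simp_all add: var_def mult_single)

lemma total_degree_sum_list: "total_degree (\<Sum>v\<leftarrow>vs. single (f v) 1) = length vs"
  by (induction vs) (simp_all add: total_degree_add del: sum.distrib)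

lemma complete_on_superset: "E \<subseteq> fold complete_at vs E"
proof (induction vs arbitrary: E)
  case (Cons v vs)
  have "E \<subseteq> complete_at v E" by (simp add: complete_at_def)
  with Cons[of "complete_at v E"] show ?case by simp
qed simp

lemma same_component_mono: "E \<subseteq> F \<Longrightarrow> same_component E i j \<Longrightarrow> same_component F i j"
  unfolding same_component_def by (erule rtrancl_mono[THEN subsetD, rotated]) auto

lemma P_empty_subset_completion:
  assumes "completion_set E W"
  shows "P_empty E \<subseteq> binomial_edge_ideal (complete_on W E)"
proof -
  have "{i, j} \<in> complete_on W E" if "same_component E i j" "i < j" for i j
  proof -
    have "same_component (complete_on W E) i j"
      unfolding complete_on_def by (rule same_component_mono[OF complete_on_superset that(1)])
    with assms that(2) show ?thesis
      unfolding completion_set_def disjoint_union_of_complete_def by (metis less_irrefl)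
  qed
  then show ?thesis
    unfolding P_empty_def binomial_edge_ideal_def ideal_span_def
    by (intro module.span_mono[OF module_times]) auto
qed

lemma binomial_edge_ideal_subset_P_empty: "binomial_edge_ideal E \<subseteq> P_empty E"
  unfolding P_empty_def binomial_edge_ideal_def ideal_span_def same_component_def
  by (intro module.span_mono[OF module_times]) auto

text \<open>The product of the variables \<open>x\<^sub>w\<close> over the completion set is a witness: it multiplies
  \<open>P\<^sub>\<emptyset>\<close> into \<open>J\<close> and is a nonzerodivisor modulo \<open>P\<^sub>\<emptyset>\<close>.\<close>

lemma local_v_number_le_completion:
  fixes E :: "'n::{finite,linorder} set set"
  assumes "completion_set E W"
  shows "local_v_number (binomial_edge_ideal E :: ('n + 'n, 'k::field) mpoly set) (P_empty E)
    \<le> enat (card W)"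
proof -
  let ?vs = "sorted_list_of_set W"
  let ?f = "(\<Prod>v\<leftarrow>?vs. var (Inl v)) :: ('n + 'n, 'k) mpoly"
  have "colon (binomial_edge_ideal E) ?f = P_empty E"
  proof
    show "colon (binomial_edge_ideal E) ?f \<subseteq> P_empty E"
    proof
      fix g assume "g \<in> colon (binomial_edge_ideal E) ?f"
      then have "?f * g \<in> P_empty E"
        using binomial_edge_ideal_subset_P_empty by (auto simp: colon_def mult.commute)
      then show "g \<in> P_empty E"
        unfolding prod_var_monomial by (rule P_empty_monomial_cancel)
    qed
    show "P_empty E \<subseteq> colon (binomial_edge_ideal E) ?f"
    proof
      fix g assume "g \<in> (P_empty E :: ('n + 'n, 'k) mpoly set)"
      then have "g \<in> binomial_edge_ideal (fold complete_at ?vs E)"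
        using P_empty_subset_completion[OF assms] by (auto simp: complete_on_def)
      from prod_var_times_complete_on[OF this] show "g \<in> colon (binomial_edge_ideal E) ?f"
        by (simp add: colon_def mult.commute)
    qed
  qed
  moreover have "?f \<in> homogeneous (card W)"
    using homogeneous_monomial[of "\<Sum>v\<leftarrow>?vs. single (Inl v) 1" 1]
    unfolding prod_var_monomial total_degree_sum_list by simp
  ultimately show ?thesis
    unfolding local_v_number_def by (intro INF_lower) blast
qed


section \<open>Linear extension from a basis\<close>

definition smul :: "'r::comm_ring_1 \<Rightarrow> ('b \<Rightarrow>\<^sub>0 'r) \<Rightarrow> ('b \<Rightarrow>\<^sub>0 'r)" where
  "smul p m = Poly_Mapping.map ((*) p) m"

lemma lookup_smul [simp]: "lookup (smul p m) b = p * lookup m b"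
  by (simp add: smul_def Poly_Mapping.map.rep_eq when_def)

lemma smul_single [simp]: "smul p (single b q) = single b (p * q)"
  by (rule poly_mapping_eqI) (simp add: lookup_single when_def)

lemma keys_smul: "keys (smul p m) \<subseteq> keys m"
  by (auto simp: in_keys_iff)

interpretation free: module smul
  by standard (auto intro!: poly_mapping_eqI simp: lookup_add algebra_simps)

text \<open>The target is an arbitrary module, since linear maps to a free module and to the ring itself both
  occur.\<close>

definition linear_extension ::
    "('r \<Rightarrow> 'm \<Rightarrow> 'm::ab_group_add) \<Rightarrow> ('b \<Rightarrow> 'm) \<Rightarrow> ('b \<Rightarrow>\<^sub>0 'r::comm_ring_1) \<Rightarrow> 'm" where
  "linear_extension scale g m = (\<Sum>b\<in>keys m. scale (lookup m b) (g b))"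

lemma lin_ext_eq: "lin_ext \<phi> = linear_extension smul \<phi>"
  by (simp add: fun_eq_iff lin_ext_def linear_extension_def smul_def)

context module
begin

lemma linear_extension_superset:
  "finite X \<Longrightarrow> keys m \<subseteq> X \<Longrightarrow> linear_extension scale g m = (\<Sum>b\<in>X. scale (lookup m b) (g b))"
  unfolding linear_extension_def by (rule sum.mono_neutral_left) (auto simp: in_keys_iff)

lemma linear_extension_add:
  "linear_extension scale g (m + n) = linear_extension scale g m + linear_extension scale g n"
proof -
  let ?X = "keys m \<union> keys n"
  have "linear_extension scale g (m + n) = (\<Sum>b\<in>?X. scale (lookup (m + n) b) (g b))"
    using keys_add[of m n] by (intro linear_extension_superset) auto
  also have "\<dots> = linear_extension scale g m + linear_extension scale g n"
    by (simp add: lookup_add scale_left_distrib sum.distrib linear_extension_superset[of ?X])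
  finally show ?thesis .
qed

lemma linear_extension_smul:
  "linear_extension scale g (smul p m) = scale p (linear_extension scale g m)"
proof -
  have "linear_extension scale g (smul p m) = (\<Sum>b\<in>keys m. scale (lookup (smul p m) b) (g b))"
    by (intro linear_extension_superset) (auto simp: keys_smul)
  then show ?thesis
    by (simp add: linear_extension_def scale_sum_right)
qed

lemma linear_extension_zero [simp]: "linear_extension scale g 0 = 0"
  by (simp add: linear_extension_def)

lemma linear_extension_single [simp]: "linear_extension scale g (single b p) = scale p (g b)"
  by (simp add: linear_extension_def)

lemma linear_extension_diff:
  "linear_extension scale g (m - n) = linear_extension scale g m - linear_extension scale g n"
  using linear_extension_add[of g "m - n" n] by (simp add: algebra_simps)

lemma linear_extension_sum:
  "linear_extension scale g (sum h X) = (\<Sum>x\<in>X. linear_extension scale g (h x))"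
  by (induction X rule: infinite_finite_induct) (simp_all add: linear_extension_add)

lemma linear_extension_comp:
  "linear_extension scale g (linear_extension smul s m) =
     linear_extension scale (\<lambda>b. linear_extension scale g (s b)) m"
  by (simp add: linear_extension_def[of smul] linear_extension_sum linear_extension_smul)
     (simp add: linear_extension_def)

lemma linear_extension_cong:
  "(\<And>b. b \<in> keys m \<Longrightarrow> g b = h b) \<Longrightarrow> linear_extension scale g m = linear_extension scale h m"
  by (simp add: linear_extension_def)

lemma linear_extension_diff_fun:
  "linear_extension scale (\<lambda>b. g b - h b) m = linear_extension scale g m - linear_extension scale h m"
  by (simp add: linear_extension_def scale_right_diff_distrib sum_subtractf)

lemma linear_extension_scale_fun:
  "linear_extension scale (\<lambda>b. scale p (g b)) m = scale p (linear_extension scale g m)"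
  by (simp add: linear_extension_def scale_sum_right mult.commute)

lemma linear_extension_mem:
  "subspace N \<Longrightarrow> (\<And>b. b \<in> keys m \<Longrightarrow> g b \<in> N) \<Longrightarrow> linear_extension scale g m \<in> N"
  unfolding linear_extension_def by (intro subspace_sum subspace_scale)

end

lemma linear_extension_basis: "linear_extension smul (\<lambda>b. single b p) m = smul p m"
proof -
  have "lookup (linear_extension smul (\<lambda>b. single b p) m) c = lookup (smul p m) c" for c
    by (cases "c \<in> keys m")
       (auto simp: linear_extension_def lookup_sum lookup_single when_def in_keys_iff mult.commute
         if_distrib cong: if_cong)
  then show ?thesis by (rule poly_mapping_eqI)
qed

lemma lookup_linear_extension:
  "lookup (linear_extension smul s m) c = (\<Sum>b\<in>keys m. lookup m b * lookup (s b) c)"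
  by (simp add: linear_extension_def lookup_sum)

lemma subspace_free_mod: "free.subspace (free_mod B)"
proof (rule free.subspaceI)
  show "m + n \<in> free_mod B" if "m \<in> free_mod B" "n \<in> free_mod B" for m n
    using that keys_add[of m n] by (auto simp: free_mod_def)
  show "smul p m \<in> free_mod B" if "m \<in> free_mod B" for p m
    using that keys_smul[of p m] by (auto simp: free_mod_def)
qed (simp add: free_mod_def)

lemma linear_extension_free_mod:
  "m \<in> free_mod B \<Longrightarrow> (\<And>b. b \<in> B \<Longrightarrow> s b \<in> free_mod C) \<Longrightarrow> linear_extension smul s m \<in> free_mod C"
  by (rule free.linear_extension_mem[OF subspace_free_mod]) (auto simp: free_mod_def)

lemma free_mod_homogeneous_subset: "free_mod_homogeneous B d D \<subseteq> free_mod B"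
  by (auto simp: free_mod_homogeneous_def)


section \<open>Monomial ideals attached to disjoint pairs of variables\<close>

text \<open>For disjoint pairs of variables \<open>a\<^sub>i\<close>, \<open>b\<^sub>i\<close>, the ideal \<open>Q A\<close> below is generated by all variables
  outside the pairs and by the products \<open>a\<^sub>j b\<^sub>j\<close>, \<open>j \<in> A\<close>. So \<open>S/Q A\<close> is the complete intersection
  of these products in the polynomial ring in the variables of the pairs, viewed as an
  \<open>S\<close>-module. As \<open>Q A\<close> is a monomial ideal, membership is decided monomial by monomial.\<close>

locale variable_pairs =
  fixes k :: nat and a b :: "nat \<Rightarrow> 'v::finite"
  assumes inj_a: "inj_on a {..<k}" and inj_b: "inj_on b {..<k}"
    and disjoint: "a ` {..<k} \<inter> b ` {..<k} = {}"
begin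

definition bad :: "nat set \<Rightarrow> ('v \<Rightarrow>\<^sub>0 nat) \<Rightarrow> bool" where
  "bad A m \<longleftrightarrow> (\<exists>w\<in>keys m. w \<notin> a ` {..<k} \<union> b ` {..<k}) \<or> (\<exists>j\<in>A. a j \<in> keys m \<and> b j \<in> keys m)"

definition Q :: "nat set \<Rightarrow> ('v, 'k::field) mpoly set" where
  "Q A = {p. \<forall>m\<in>keys p. bad A m}"

abbreviation z :: "nat \<Rightarrow> ('v, 'k::field) mpoly" where
  "z i \<equiv> single (single (a i) 1 + single (b i) 1) 1"

lemma bad_mono: "A \<subseteq> A' \<Longrightarrow> bad A m \<Longrightarrow> bad A' m"
  by (auto simp: bad_def)

lemma bad_add: "bad A m \<Longrightarrow> bad A (n + m)"
  by (auto simp: bad_def in_keys_iff lookup_add)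

lemma not_bad_0: "\<not> bad A 0"
  by (simp add: bad_def)

lemma Q_mono: "A \<subseteq> A' \<Longrightarrow> Q A \<subseteq> Q A'"
  by (auto simp: Q_def bad_mono)

lemma subspace_Q: "module.subspace (*) (Q A)"
proof (rule module.subspaceI[OF module_times])
  show "0 \<in> Q A" by (simp add: Q_def)
  show "p + q \<in> Q A" if "p \<in> Q A" "q \<in> Q A" for p q
    using that keys_add[of p q] by (auto simp: Q_def)
  show "c * p \<in> Q A" if "p \<in> Q A" for c p
    using that keys_mult[of c p] bad_add by (fastforce simp: Q_def)
qed

lemmas Q_0 = module.subspace_0[OF module_times subspace_Q]
  and Q_add = module.subspace_add[OF module_times subspace_Q]
  and Q_diff = module.subspace_diff[OF module_times subspace_Q]
  and Q_times = module.subspace_scale[OF module_times subspace_Q]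
  and Q_sum = module.subspace_sum[OF module_times subspace_Q]

lemma Q_times': "p \<in> Q A \<Longrightarrow> p * q \<in> Q A"
  using Q_times[of p A q] by (simp add: mult.commute)

lemma lookup_0_Q: "p \<in> Q A \<Longrightarrow> lookup p 0 = 0"
  using not_bad_0 by (auto simp: Q_def not_in_keys_iff_lookup_eq_zero[symmetric])

lemma z_in_Q: "i \<in> A \<Longrightarrow> z i \<in> Q A"
  by (auto simp: Q_def bad_def in_keys_iff lookup_add dest!: bspec[of A _ i])

text \<open>Multiplication by \<open>a\<^sub>i b\<^sub>i\<close> is injective on \<open>S/Q A\<close>, since for \<open>i \<notin> A\<close> its two variables
  occur in no generator of \<open>Q A\<close>.\<close>

lemma z_cancel:
  assumes "z i * p \<in> Q A" "i < k" "i \<notin> A" "A \<subseteq> {..<k}"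
  shows "p \<in> Q A"
  unfolding Q_def
proof safe
  fix m assume m: "m \<in> keys p"
  let ?e = "single (a i) 1 + single (b i) 1 :: 'v \<Rightarrow>\<^sub>0 nat"
  have "bad A (?e + m)"
    using assms(1) m by (auto simp: Q_def keys_monomial_times)
  moreover have e: "keys ?e \<subseteq> {a i, b i}"
    by (auto simp: in_keys_iff lookup_add lookup_single when_def split: if_splits)
  moreover have "a j \<notin> {a i, b i}" "b j \<notin> {a i, b i}" if "j \<in> A" for j
  proof -
    have "j < k" "j \<noteq> i" using that assms by auto
    then show "a j \<notin> {a i, b i}" "b j \<notin> {a i, b i}"
      using disjoint inj_a inj_b assms(2) by (auto simp: inj_on_def)
  qed
  moreover have "keys (?e + m) \<subseteq> {a i, b i} \<union> keys m"
    using keys_add[of ?e m] e by blast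
  ultimately show "bad A m"
    using assms(2) unfolding bad_def by blast
qed

text \<open>An element of \<open>Q A + (a\<^sub>i b\<^sub>i)\<close> is a multiple of \<open>a\<^sub>i b\<^sub>i\<close> modulo \<open>Q A\<close>. The quotient divides the terms
  outside \<open>Q A\<close> one by one, so that it inherits homogeneity; this is what the clause on monomials
  is for.\<close>

lemma Q_divide:
  assumes "p \<in> Q (insert i A)" "i < k"
  shows "\<exists>q. p - z i * q \<in> Q A \<and> (\<forall>m\<in>keys q. single (a i) 1 + single (b i) 1 + m \<in> keys p)"
proof -
  let ?e = "single (a i) 1 + single (b i) 1 :: 'v \<Rightarrow>\<^sub>0 nat"
  define K where "K = {m \<in> keys p. \<not> bad A m}"
  define q where "q = (\<Sum>m\<in>K. single (m - ?e) (lookup p m))"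
  have ab: "a i \<noteq> b i" using disjoint assms(2) by blast
  have e: "?e + (m - ?e) = m" if "m \<in> K" for m
  proof -
    have "a i \<in> keys m" "b i \<in> keys m"
      using that assms(1) by (auto simp: K_def Q_def bad_def)
    with ab show ?thesis
      by (intro poly_mapping_eqI)
         (auto simp: lookup_add lookup_minus lookup_single when_def in_keys_iff)
  qed
  have K: "finite K" by (simp add: K_def)
  have "z i * q = (\<Sum>m\<in>K. single m (lookup p m))"
    by (simp add: q_def sum_distrib_left mult_single e del: One_nat_def cong: sum.cong)
  moreover have "p = (\<Sum>m\<in>K. single m (lookup p m)) + (\<Sum>m\<in>keys p - K. single m (lookup p m))"
    by (subst add.commute, subst sum.subset_diff[symmetric])
       (auto simp: K_def poly_mapping_sum_monomials)
  ultimately have "p - z i * q = (\<Sum>m\<in>keys p - K. single m (lookup p m))"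
    by (metis add_diff_cancel_left')
  also have "\<dots> \<in> Q A"
    by (rule Q_sum) (auto simp: K_def Q_def)
  finally have "p - z i * q \<in> Q A" .
  moreover have "?e + m \<in> keys p" if "m \<in> keys q" for m
  proof -
    have "m \<in> (\<Union>n\<in>K. keys (single (n - ?e) (lookup p n)))"
      using that unfolding q_def by (rule subsetD[OF keys_sum_subset])
    then obtain n where "n \<in> K" "m = n - ?e"
      by (auto split: if_splits)
    with e show ?thesis by (auto simp: K_def)
  qed
  ultimately show ?thesis by blast
qed

end


section \<open>A generator of degree 2k in homological degree k\<close>

lemma resolutionD:
  assumes "minimal_graded_free_resolution I B d \<phi>"
  shows "B 0 = {0}" "d 0 0 = 0"
    and "c \<in> B (Suc i) \<Longrightarrow> \<phi> i c \<in> free_mod_homogeneous (B i) (d i) (d (Suc i) c)"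
    and "linear_extension smul (\<phi> 0) ` free_mod (B 1) = {m \<in> free_mod (B 0). lookup m 0 \<in> I}"
    and "linear_extension smul (\<phi> (Suc i)) ` free_mod (B (Suc (Suc i))) =
      {m \<in> free_mod (B (Suc i)). linear_extension smul (\<phi> i) m = 0}"
proof -
  note * = assms[unfolded minimal_graded_free_resolution_def lin_ext_eq]
  from * show "B 0 = {0}" by (elim conjE)
  from * show "d 0 0 = 0" by (elim conjE)
  from * have "\<forall>i. \<forall>b\<in>B (Suc i). \<phi> i b \<in> free_mod_homogeneous (B i) (d i) (d (Suc i) b)"
    by (elim conjE)
  then show "c \<in> B (Suc i) \<Longrightarrow> \<phi> i c \<in> free_mod_homogeneous (B i) (d i) (d (Suc i) c)"
    by blast
  from * show "linear_extension smul (\<phi> 0) ` free_mod (B 1) = {m \<in> free_mod (B 0). lookup m 0 \<in> I}"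
    by (elim conjE)
  from * have "\<forall>i. linear_extension smul (\<phi> (Suc i)) ` free_mod (B (Suc (Suc i))) =
      {m \<in> free_mod (B (Suc i)). linear_extension smul (\<phi> i) m = 0}"
    by (elim conjE)
  then show "linear_extension smul (\<phi> (Suc i)) ` free_mod (B (Suc (Suc i))) =
      {m \<in> free_mod (B (Suc i)). linear_extension smul (\<phi> i) m = 0}" ..
qed

text \<open>Multiplication by \<open>f \<in> I\<close> is zero on \<open>S/I\<close>, hence homotopic to zero on a resolution: the maps
  \<open>\<sigma> i : F\<^sub>i \<rightarrow> F\<^sub>i\<^sub>+\<^sub>1\<close> satisfy \<open>\<partial>\<sigma> + \<sigma>\<partial> = f\<close>. They are chosen on the bases, one homological degree
  after the other; each choice is possible because \<open>f c - \<sigma>(\<partial>c)\<close> is a cycle.\<close>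

lemma multiplication_homotopy:
  assumes res: "minimal_graded_free_resolution I B d \<phi>" and f: "f \<in> I"
  shows "\<exists>\<sigma>. (\<forall>i. \<forall>c\<in>B i. \<sigma> i c \<in> free_mod (B (Suc i))) \<and>
    (\<forall>c\<in>B 0. linear_extension smul (\<phi> 0) (\<sigma> 0 c) = single c f) \<and>
    (\<forall>i. \<forall>c\<in>B (Suc i). linear_extension smul (\<phi> (Suc i)) (\<sigma> (Suc i) c) =
        single c f - linear_extension smul (\<sigma> i) (\<phi> i c))"
proof -
  let ?L = "\<lambda>i. linear_extension smul (\<phi> i)"
  note B0 = resolutionD(1)[OF res] and ex0 = resolutionD(4)[OF res] and exS = resolutionD(5)[OF res]
  have \<phi>: "\<And>i c. c \<in> B (Suc i) \<Longrightarrow> \<phi> i c \<in> free_mod (B i)"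
    using resolutionD(3)[OF res] free_mod_homogeneous_subset by blast
  \<comment> \<open>The last clause of \<open>P\<close>, \<open>\<partial>\<sigma> = f\<close> on boundaries, is what remains of the homotopy identity when
    the map in the previous degree is forgotten; it suffices for the next choice.\<close>
  define P where "P i s \<longleftrightarrow> (\<forall>c\<in>B i. s c \<in> free_mod (B (Suc i))) \<and>
      (i = 0 \<longrightarrow> (\<forall>c\<in>B 0. ?L 0 (s c) = single c f)) \<and>
      (\<forall>x \<in> ?L i ` free_mod (B (Suc i)). ?L i (linear_extension smul s x) = smul f x)"
    for i and s :: "nat \<Rightarrow> nat \<Rightarrow>\<^sub>0 _"
  define R where "R i s s' \<longleftrightarrow> (\<forall>c\<in>B (Suc i). ?L (Suc i) (s' c) =
        single c f - linear_extension smul s (\<phi> i c))" for i and s s' :: "nat \<Rightarrow> nat \<Rightarrow>\<^sub>0 _"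
  have "\<exists>s. P 0 s"
  proof -
    have "single 0 f \<in> ?L 0 ` free_mod (B 1)"
      unfolding ex0 by (simp add: B0 free_mod_def f)
    then obtain y where y: "y \<in> free_mod (B 1)" "?L 0 y = single 0 f" by auto
    have "?L 0 (linear_extension smul (\<lambda>c. y) x) = smul f x" if "x \<in> ?L 0 ` free_mod (B (Suc 0))" for x
    proof -
      have "keys x \<subseteq> {0}" using that ex0 by (auto simp: B0 free_mod_def)
      then have "?L 0 (linear_extension smul (\<lambda>c. y) x) = linear_extension smul (\<lambda>c. single c f) x"
        unfolding free.linear_extension_comp y(2) by (intro free.linear_extension_cong) auto
      then show ?thesis by (simp add: linear_extension_basis)
    qed
    then have "P 0 (\<lambda>c. y)" using y by (auto simp: P_def B0)
    then show ?thesis by (rule exI[of "P 0"])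
  qed
  moreover have "\<exists>s'. P (Suc i) s' \<and> R i s s'" if P: "P i s" for i s
  proof -
    have "\<exists>y. y \<in> free_mod (B (Suc (Suc i))) \<and>
        ?L (Suc i) y = single c f - linear_extension smul s (\<phi> i c)" if c: "c \<in> B (Suc i)" for c
    proof -
      have "\<phi> i c \<in> ?L i ` free_mod (B (Suc i))"
        by (rule image_eqI[of _ _ "single c 1"]) (use c in \<open>auto simp: free_mod_def\<close>)
      with P have "?L i (linear_extension smul s (\<phi> i c)) = smul f (\<phi> i c)"
        unfolding P_def by blast
      then have "?L i (single c f - linear_extension smul s (\<phi> i c)) = 0"
        by (simp add: free.linear_extension_diff)
      moreover have "single c f - linear_extension smul s (\<phi> i c) \<in> free_mod (B (Suc i))"
        using P c by (intro free.subspace_diff[OF subspace_free_mod] linear_extension_free_mod[OF \<phi>[OF c]])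
          (auto simp: P_def free_mod_def split: if_splits)
      ultimately have "single c f - linear_extension smul s (\<phi> i c) \<in> ?L (Suc i) ` free_mod (B (Suc (Suc i)))"
        unfolding exS by blast
      then show ?thesis by auto
    qed
    then obtain s' where s': "\<And>c. c \<in> B (Suc i) \<Longrightarrow> s' c \<in> free_mod (B (Suc (Suc i)))"
        "\<And>c. c \<in> B (Suc i) \<Longrightarrow> ?L (Suc i) (s' c) = single c f - linear_extension smul s (\<phi> i c)"
      by metis
    have "?L (Suc i) (linear_extension smul s' x) = smul f x"
      if "x \<in> ?L (Suc i) ` free_mod (B (Suc (Suc i)))" for x
    proof -
      from that have x: "x \<in> free_mod (B (Suc i))" "?L i x = 0" unfolding exS by auto
      have "?L (Suc i) (linear_extension smul s' x)
          = linear_extension smul (\<lambda>c. single c f - linear_extension smul s (\<phi> i c)) x"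
        unfolding free.linear_extension_comp
        using x(1) s'(2) by (intro free.linear_extension_cong) (auto simp: free_mod_def)
      also have "\<dots> = smul f x - linear_extension smul s (?L i x)"
        by (simp add: free.linear_extension_diff_fun linear_extension_basis free.linear_extension_comp)
      finally show ?thesis by (simp add: x(2))
    qed
    then have "P (Suc i) s' \<and> R i s s'"
      using s' by (auto simp: P_def R_def)
    then show ?thesis by blast
  qed
  ultimately obtain \<sigma> where "\<And>i. P i (\<sigma> i)" "\<And>i. R i (\<sigma> i) (\<sigma> (Suc i))"
    using dependent_nat_choice[of P R] by blast
  then show ?thesis by (intro exI[of _ \<sigma>]) (auto simp: P_def R_def)
qed

context variable_pairs
begin

text \<open>The induction produces, for \<open>i \<le> k\<close>, a linear map \<open>g : F\<^sub>i \<rightarrow> S\<close> that is homogeneous of degree \<open>-2i\<close>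
  and an element \<open>\<alpha> \<in> F\<^sub>i\<close> such that \<open>g \<alpha>\<close> has constant term \<open>1\<close>. It starts with the identity and
  \<open>1 \<in> F\<^sub>0 = S\<close>. In the end, some basis element \<open>c\<close> of \<open>F\<^sub>k\<close> has an image with nonzero constant term,
  and by homogeneity its degree is \<open>2k\<close>.

  The map \<open>g\<close> is a cocycle modulo \<open>Q {i..<k}\<close>. So \<open>g \<circ> \<partial>\<close> takes values in
  \<open>Q {Suc i..<k} + (z i)\<close>, and dividing by \<open>z i\<close> gives the next map \<open>g'\<close>; that it is again a cocycle
  follows from \<open>\<partial>\<partial> = 0\<close> and cancellation of \<open>z i\<close>. The next element is \<open>\<alpha>' = \<sigma> \<alpha>\<close> for the homotopy
  \<open>\<sigma>\<close> of multiplication by \<open>f i\<close>. Modulo \<open>Q {Suc i..<k}\<close> one has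
  \<open>z i g'(\<alpha>') = g(\<partial>\<sigma>\<alpha>) = f i g(\<alpha>) - g(\<sigma>\<partial>\<alpha>)\<close>, where \<open>f i\<close> is \<open>z i\<close> up to killed variables and
  \<open>\<partial>\<alpha>\<close> involves only multiples of \<open>f 0, \<dots>, f (i - 1)\<close>. Cancelling \<open>z i\<close>, the values \<open>g'(\<alpha>')\<close> and \<open>g(\<alpha>)\<close>
  agree modulo killed variables and the other \<open>z j\<close>, and in particular in their constant terms.\<close>

lemma resolution_has_generator:
  fixes I :: "('v, 'k::field) mpoly set"
  assumes res: "minimal_graded_free_resolution I B d \<phi>"
    and fI: "\<And>i. i < k \<Longrightarrow> f i \<in> I"
    and fz: "\<And>i. i < k \<Longrightarrow> f i - z i \<in> Q {}"
    and IQ: "I \<subseteq> Q {..<k}"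
  shows "\<exists>c\<in>B k. d k c = 2 * k"
proof -
  let ?L = "\<lambda>i. linear_extension smul (\<phi> i)"
  let ?E = "linear_extension (*) :: (nat \<Rightarrow> ('v, 'k) mpoly) \<Rightarrow> _"
  note E_diff = module.linear_extension_diff[OF module_times]
    and E_comp = module.linear_extension_comp[OF module_times]
    and E_smul = module.linear_extension_smul[OF module_times]
  note B0 = resolutionD(1)[OF res] and d0 = resolutionD(2)[OF res] and \<phi>h = resolutionD(3)[OF res]
    and ex0 = resolutionD(4)[OF res] and exS = resolutionD(5)[OF res]
  have \<phi>: "\<And>i c. c \<in> B (Suc i) \<Longrightarrow> \<phi> i c \<in> free_mod (B i)"
    using \<phi>h free_mod_homogeneous_subset by blast
  define C where "C i g \<alpha> \<longleftrightarrow> (\<forall>c\<in>B i. \<forall>m\<in>keys (g c). total_degree m + 2 * i = d i c) \<and>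
      (\<forall>x \<in> ?L i ` free_mod (B (Suc i)). ?E g x \<in> Q {i..<k}) \<and> \<alpha> \<in> free_mod (B i) \<and>
      (\<forall>j. i = Suc j \<longrightarrow> (\<forall>c. lookup (?L j \<alpha>) c \<in> Q {..<i})) \<and> lookup (?E g \<alpha>) 0 = 1"
    for i g \<alpha>
  have "i \<le> k \<Longrightarrow> \<exists>g \<alpha>. C i g \<alpha>" for i
  proof (induction i)
    case 0
    have "?E (\<lambda>_. 1) x \<in> Q {0..<k}" if "x \<in> ?L 0 ` free_mod (B (Suc 0))" for x
    proof -
      have x: "keys x \<subseteq> {0}" "lookup x 0 \<in> I" using that ex0 by (auto simp: B0 free_mod_def)
      then have "?E (\<lambda>_. 1) x = lookup x 0"
        by (subst module.linear_extension_superset[OF module_times, of "{0}"]) auto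
      with x IQ show ?thesis by (auto simp: atLeast0LessThan)
    qed
    moreover have "lookup (?E (\<lambda>_. 1) (single 0 1)) 0 = 1"
      by (simp add: module.linear_extension_single[OF module_times] del: single_one)
    ultimately have "C 0 (\<lambda>_. 1) (single 0 1)"
      unfolding C_def by (auto simp: B0 d0 free_mod_def)
    then show ?case by blast
  next
    case (Suc i)
    then have ik: "i < k" by simp
    from Suc.IH[OF less_imp_le[OF ik]] obtain g \<alpha> where "C i g \<alpha>" by blast
    then have
        g_deg: "\<And>c m. c \<in> B i \<Longrightarrow> m \<in> keys (g c) \<Longrightarrow> total_degree m + 2 * i = d i c"
        and g_Q: "\<And>x. x \<in> ?L i ` free_mod (B (Suc i)) \<Longrightarrow> ?E g x \<in> Q {i..<k}"
        and \<alpha>: "\<alpha> \<in> free_mod (B i)"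
        and \<alpha>_Q: "\<And>j c. i = Suc j \<Longrightarrow> lookup (?L j \<alpha>) c \<in> Q {..<i}"
        and const: "lookup (?E g \<alpha>) 0 = 1"
      unfolding C_def by blast+
    have ins: "{i..<k} = insert i {Suc i..<k}" using ik by auto
    \<comment> \<open>The next map, by division.\<close>
    have "\<exists>q. ?E g (\<phi> i c) - z i * q \<in> Q {Suc i..<k} \<and>
        (\<forall>m\<in>keys q. total_degree m + 2 * Suc i = d (Suc i) c)" if c: "c \<in> B (Suc i)" for c
    proof -
      have "\<phi> i c \<in> ?L i ` free_mod (B (Suc i))"
        by (rule image_eqI[of _ _ "single c 1"]) (use c in \<open>auto simp: free_mod_def\<close>)
      from Q_divide[OF g_Q[OF this, unfolded ins] ik] obtain q where
        q: "?E g (\<phi> i c) - z i * q \<in> Q {Suc i..<k}"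
          "\<And>m. m \<in> keys q \<Longrightarrow> single (a i) 1 + single (b i) 1 + m \<in> keys (?E g (\<phi> i c))" by blast
      have "total_degree m + 2 * i = d (Suc i) c" if m: "m \<in> keys (?E g (\<phi> i c))" for m
      proof -
        obtain e where e: "e \<in> keys (\<phi> i c)" "m \<in> keys (lookup (\<phi> i c) e * g e)"
          using subsetD[OF keys_sum_subset m[unfolded linear_extension_def]] by blast
        then obtain m1 m2 where m12: "m = m1 + m2" "m1 \<in> keys (lookup (\<phi> i c) e)" "m2 \<in> keys (g e)"
          using keys_mult[of "lookup (\<phi> i c) e" "g e"] by auto
        have "e \<in> B i" "d i e \<le> d (Suc i) c" "lookup (\<phi> i c) e \<in> homogeneous (d (Suc i) c - d i e)"
          using \<phi>h[OF c] e(1) by (auto simp: free_mod_homogeneous_def free_mod_def)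
        with homogeneousD[OF this(3) m12(2)] g_deg[OF _ m12(3)] show ?thesis
          unfolding m12(1) total_degree_add by auto
      qed
      from this[OF q(2)] have "total_degree m + 2 * Suc i = d (Suc i) c" if "m \<in> keys q" for m
        using that unfolding total_degree_add total_degree_single by fastforce
      with q(1) show ?thesis by blast
    qed
    then obtain g' where
        g': "\<And>c. c \<in> B (Suc i) \<Longrightarrow> ?E g (\<phi> i c) - z i * g' c \<in> Q {Suc i..<k}"
        and g'_deg: "\<And>c m. c \<in> B (Suc i) \<Longrightarrow> m \<in> keys (g' c) \<Longrightarrow> total_degree m + 2 * Suc i = d (Suc i) c"
      by metis
    have gg': "?E g (?L i x) - z i * ?E g' x \<in> Q {Suc i..<k}" if x: "x \<in> free_mod (B (Suc i))" for x
    proof -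
      have "?E g (?L i x) - z i * ?E g' x = ?E (\<lambda>c. ?E g (\<phi> i c) - z i * g' c) x"
        by (simp add: E_comp module.linear_extension_diff_fun[OF module_times]
            module.linear_extension_scale_fun[OF module_times])
      also have "\<dots> \<in> Q {Suc i..<k}"
        using x g' by (intro module.linear_extension_mem[OF module_times subspace_Q])
          (auto simp: free_mod_def)
      finally show ?thesis .
    qed
    have g'_Q: "?E g' x \<in> Q {Suc i..<k}" if "x \<in> ?L (Suc i) ` free_mod (B (Suc (Suc i)))" for x
    proof -
      from that have x: "x \<in> free_mod (B (Suc i))" "?L i x = 0" unfolding exS by auto
      have "z i * ?E g' x \<in> Q {Suc i..<k}"
        using Q_diff[OF Q_0 gg'[OF x(1)]] by (simp add: x(2) module.linear_extension_zero[OF module_times])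
      then show ?thesis using ik by (rule z_cancel) auto
    qed
    from multiplication_homotopy[OF res fI[OF ik]] obtain \<sigma> where
        \<sigma>: "\<And>i c. c \<in> B i \<Longrightarrow> \<sigma> i c \<in> free_mod (B (Suc i))"
        and \<sigma>0: "\<And>c. c \<in> B 0 \<Longrightarrow> ?L 0 (\<sigma> 0 c) = single c (f i)"
        and \<sigma>S: "\<And>j c. c \<in> B (Suc j) \<Longrightarrow> ?L (Suc j) (\<sigma> (Suc j) c) =
          single c (f i) - linear_extension smul (\<sigma> j) (\<phi> j c)"
      by metis
    define \<alpha>' where "\<alpha>' = linear_extension smul (\<sigma> i) \<alpha>"
    have \<alpha>': "\<alpha>' \<in> free_mod (B (Suc i))"
      unfolding \<alpha>'_def using \<alpha> \<sigma> by (rule linear_extension_free_mod)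
    \<comment> \<open>Here \<open>r = \<sigma> (\<partial> \<alpha>)\<close>, to be read as \<open>0\<close> in degree \<open>0\<close>, where \<open>\<alpha>\<close> has no boundary.\<close>
    obtain r where r: "?L i \<alpha>' = smul (f i) \<alpha> - r" "\<And>c. lookup r c \<in> Q {..<i}"
    proof (cases i)
      case 0
      have "?L i \<alpha>' = smul (f i) \<alpha> - 0"
        unfolding \<alpha>'_def free.linear_extension_comp using \<alpha> \<sigma>0
        by (subst free.linear_extension_cong[where h = "\<lambda>c. single c (f i)"])
           (auto simp: 0 free_mod_def linear_extension_basis)
      from that[OF this] show thesis by (simp add: Q_0)
    next
      case (Suc j)
      have "?L i \<alpha>' = smul (f i) \<alpha> - linear_extension smul (\<sigma> j) (?L j \<alpha>)"
        unfolding \<alpha>'_def free.linear_extension_comp using \<alpha> \<sigma>S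
        by (subst free.linear_extension_cong[where
              h = "\<lambda>c. single c (f i) - linear_extension smul (\<sigma> j) (\<phi> j c)"])
           (auto simp: Suc free_mod_def free.linear_extension_diff_fun linear_extension_basis)
      moreover have "lookup (linear_extension smul (\<sigma> j) (?L j \<alpha>)) c \<in> Q {..<i}" for c
        unfolding lookup_linear_extension[of "\<sigma> j"] by (intro Q_sum Q_times' \<alpha>_Q Suc)
      ultimately show thesis by (rule that)
    qed
    have fQ: "f i \<in> Q {i}"
      using Q_add[OF Q_mono[THEN subsetD, OF _ fz[OF ik]] z_in_Q[of i "{i}"]] by simp
    have \<alpha>'_Q: "lookup (?L i \<alpha>') c \<in> Q {..<Suc i}" for c
      using Q_times'[OF fQ] r(2)[of c]
      unfolding r(1) by (auto simp: lookup_minus intro!: Q_diff intro: Q_mono[THEN subsetD, rotated])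
    have "lookup (?E g' \<alpha>') 0 = 1"
    proof -
      \<comment> \<open>The error terms lie in \<open>Q {Suc i..<k}\<close>, \<open>Q {..<i}\<close> and \<open>Q {}\<close>. The ideal \<open>Q ?A\<close> contains
        them all, and \<open>z i\<close> is still cancellable modulo it.\<close>
      let ?A = "{..<k} - {i}"
      have "?E g (smul (f i) \<alpha> - r) - z i * ?E g' \<alpha>' \<in> Q ?A"
        using gg'[OF \<alpha>'] unfolding r(1) by (rule Q_mono[THEN subsetD, rotated]) auto
      moreover have "?E g r \<in> Q ?A"
        unfolding linear_extension_def
        by (intro Q_sum Q_times' Q_mono[THEN subsetD, OF _ r(2)]) (use ik in auto)
      moreover have "(f i - z i) * ?E g \<alpha> \<in> Q ?A"
        by (intro Q_times' Q_mono[THEN subsetD, OF _ fz[OF ik]]) auto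
      moreover have "z i * (?E g \<alpha> - ?E g' \<alpha>') =
          (?E g (smul (f i) \<alpha> - r) - z i * ?E g' \<alpha>') + ?E g r - (f i - z i) * ?E g \<alpha>"
        by (simp add: E_diff E_smul left_diff_distrib right_diff_distrib)
      ultimately have "z i * (?E g \<alpha> - ?E g' \<alpha>') \<in> Q ?A"
        by (simp only: Q_add Q_diff)
      then have "?E g \<alpha> - ?E g' \<alpha>' \<in> Q ?A"
        using ik by (rule z_cancel) auto
      from lookup_0_Q[OF this] const show ?thesis by (simp add: lookup_minus)
    qed
    with g'_deg g'_Q \<alpha>' \<alpha>'_Q have "C (Suc i) g' \<alpha>'" unfolding C_def by blast
    then show ?case by blast
  qed
  from this[OF order_refl] obtain g \<alpha> where "C k g \<alpha>" by blast
  then have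
      deg: "\<And>c m. c \<in> B k \<Longrightarrow> m \<in> keys (g c) \<Longrightarrow> total_degree m + 2 * k = d k c"
      and \<alpha>: "\<alpha> \<in> free_mod (B k)" and const: "lookup (?E g \<alpha>) 0 = 1"
    unfolding C_def by blast+
  have "(\<Sum>c\<in>keys \<alpha>. lookup (lookup \<alpha> c) 0 * lookup (g c) 0) \<noteq> 0"
    using const by (simp add: linear_extension_def lookup_sum lookup_times_zero)
  then obtain c where "c \<in> keys \<alpha>" "lookup (lookup \<alpha> c) 0 * lookup (g c) 0 \<noteq> 0"
    by (meson sum.neutral)
  then have "c \<in> B k" "0 \<in> keys (g c)" using \<alpha> by (auto simp: free_mod_def in_keys_iff)
  from deg[OF this] \<open>c \<in> B k\<close> show ?thesis by auto
qed

end


section \<open>Homogeneous components in graded free modules\<close>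

abbreviation FH :: "nat set \<Rightarrow> (nat \<Rightarrow> nat) \<Rightarrow> nat \<Rightarrow> (nat \<Rightarrow>\<^sub>0 ('v::finite, 'k::field) mpoly) set" where
  "FH \<equiv> free_mod_homogeneous"

lemma term_decomposition:
  "m = (\<Sum>c\<in>keys m. \<Sum>t\<in>keys (lookup m c). single c (single t (lookup (lookup m c) t)))"
proof -
  have "(\<Sum>t\<in>keys (lookup m c). single c (single t (lookup (lookup m c) t)))
      = single c (\<Sum>t\<in>keys (lookup m c). single t (lookup (lookup m c) t))" for c
    by (rule sum_comp_morphism[unfolded comp_def]) (simp_all add: single_add)
  then show ?thesis by (simp add: poly_mapping_sum_monomials)
qed

definition hcomp :: "(nat \<Rightarrow> nat) \<Rightarrow> nat \<Rightarrow> (nat \<Rightarrow>\<^sub>0 ('v::finite, 'k::field) mpoly) \<Rightarrow>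
    (nat \<Rightarrow>\<^sub>0 ('v, 'k) mpoly)" where
  "hcomp d D m = (\<Sum>c\<in>keys m. \<Sum>t | t \<in> keys (lookup m c) \<and> total_degree t + d c = D.
     single c (single t (lookup (lookup m c) t)))"

lemma lookup_hcomp:
  "lookup (lookup (hcomp d D m) c) t = (lookup (lookup m c) t when total_degree t + d c = D)"
proof -
  have "lookup (lookup (hcomp d D m) c) t =
      (\<Sum>c'\<in>keys m. \<Sum>t' | t' \<in> keys (lookup m c') \<and> total_degree t' + d c' = D.
        if c' = c then (if t' = t then lookup (lookup m c) t else 0) else 0)"
    unfolding hcomp_def lookup_sum
    by (intro sum.cong refl) (auto simp: lookup_single when_def)
  also have "\<dots> = (\<Sum>c'\<in>keys m. if c' = c then
      (\<Sum>t' | t' \<in> keys (lookup m c) \<and> total_degree t' + d c = D.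
        if t' = t then lookup (lookup m c) t else 0) else 0)"
    by (intro sum.cong refl) auto
  also have "\<dots> = (lookup (lookup m c) t when total_degree t + d c = D)"
    by (auto simp: when_def not_in_keys_iff_lookup_eq_zero)
  finally show ?thesis .
qed

lemma free_eqI: "(\<And>c t. lookup (lookup m c) t = lookup (lookup n c) t) \<Longrightarrow> m = n"
  by (intro poly_mapping_eqI)

lemma hcomp_add: "hcomp d D (m + n) = hcomp d D m + hcomp d D n"
  by (rule free_eqI) (simp add: lookup_hcomp lookup_add when_add_distrib)

lemma hcomp_zero [simp]: "hcomp d D 0 = 0"
  by (simp add: hcomp_def)

lemma hcomp_sum: "hcomp d D (sum f X) = (\<Sum>x\<in>X. hcomp d D (f x))"
  by (induction X rule: infinite_finite_induct) (simp_all add: hcomp_add)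

text \<open>The degree of a term \<open>t e\<^sub>c\<close> of the free module is the degree of \<open>t\<close> plus \<open>d c\<close>. This form
  avoids the truncated difference \<open>D - d c\<close>.\<close>

lemma FH_iff:
  "m \<in> FH B d D \<longleftrightarrow> m \<in> free_mod B \<and>
     (\<forall>c t. lookup (lookup m c) t \<noteq> 0 \<longrightarrow> total_degree t + d c = D)"
proof
  assume m: "m \<in> FH B d D"
  have "total_degree t + d c = D" if "lookup (lookup m c) t \<noteq> 0" for c t
  proof -
    have "c \<in> keys m" "t \<in> keys (lookup m c)" using that by (auto simp: in_keys_iff)
    with m show ?thesis by (force simp: free_mod_homogeneous_def homogeneous_def)
  qed
  with m show "m \<in> free_mod B \<and> (\<forall>c t. lookup (lookup m c) t \<noteq> 0 \<longrightarrow> total_degree t + d c = D)"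
    using free_mod_homogeneous_subset by blast
next
  assume m: "m \<in> free_mod B \<and> (\<forall>c t. lookup (lookup m c) t \<noteq> 0 \<longrightarrow> total_degree t + d c = D)"
  have "d c \<le> D \<and> lookup m c \<in> homogeneous (D - d c)" if c: "c \<in> keys m" for c
  proof
    have "keys (lookup m c) \<noteq> {}"
      using c by (metis empty_iff in_keys_iff lookup_zero poly_mapping_eqI)
    then show "d c \<le> D" using m by (fastforce simp: in_keys_iff)
    show "lookup m c \<in> homogeneous (D - d c)"
      using m by (fastforce simp: in_keys_iff homogeneous_def)
  qed
  with m show "m \<in> FH B d D" by (simp add: free_mod_homogeneous_def)
qed

lemma hcomp_free_mod: "m \<in> free_mod B \<Longrightarrow> hcomp d D m \<in> free_mod B"
  unfolding free_mod_def
proof safe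
  fix c assume m: "keys m \<subseteq> B" and c: "c \<in> keys (hcomp d D m)"
  have "c \<in> keys m"
  proof (rule ccontr)
    assume "c \<notin> keys m"
    then have "lookup (hcomp d D m) c = 0"
      by (intro poly_mapping_eqI) (simp add: lookup_hcomp not_in_keys_iff_lookup_eq_zero)
    with c show False by (simp add: in_keys_iff)
  qed
  with m show "c \<in> B" by blast
qed

lemma hcomp_in_FH: "m \<in> free_mod B \<Longrightarrow> hcomp d D m \<in> FH B d D"
  by (auto simp: FH_iff hcomp_free_mod lookup_hcomp)

lemma hcomp_FH:
  assumes "m \<in> FH B d D'"
  shows "hcomp d D m = (if D = D' then m else 0)"
proof (rule free_eqI)
  fix c t
  show "lookup (lookup (hcomp d D m) c) t = lookup (lookup (if D = D' then m else 0) c) t"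
    using assms by (cases "lookup (lookup m c) t = 0") (auto simp: FH_iff lookup_hcomp)
qed

lemma sum_hcomp: "\<exists>X. finite X \<and> m = (\<Sum>D\<in>X. hcomp d D m)"
proof -
  let ?X = "\<Union>c\<in>keys m. (\<lambda>t. total_degree t + d c) ` keys (lookup m c)"
  have "lookup (lookup m c) t = lookup (lookup (\<Sum>D\<in>?X. hcomp d D m) c) t" for c t
  proof (cases "lookup (lookup m c) t = 0")
    case True
    then show ?thesis by (simp add: lookup_sum lookup_hcomp)
  next
    case False
    then have "total_degree t + d c \<in> ?X" by (force simp: in_keys_iff)
    moreover have "finite ?X" by simp
    ultimately show ?thesis by (simp add: lookup_sum lookup_hcomp when_def sum.delta del: finite_UN)
  qed
  then have "m = (\<Sum>D\<in>?X. hcomp d D m)" by (rule free_eqI)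
  then show ?thesis by (intro exI[of _ ?X]) simp
qed

lemma monomial_smul_FH:
  assumes m: "m \<in> FH B d D"
  shows "smul (single t x) m \<in> FH B d (total_degree t + D)"
  unfolding FH_iff
proof (intro conjI allI impI)
  show "smul (single t x) m \<in> free_mod B"
    using m free_mod_homogeneous_subset free.subspace_scale[OF subspace_free_mod] by blast
  fix c s assume "lookup (lookup (smul (single t x) m) c) s \<noteq> 0"
  then have "s \<in> keys (single t x * lookup m c)" by (simp add: in_keys_iff)
  then obtain s' where "s = t + s'" "s' \<in> keys (lookup m c)"
    using keys_mult[of "single t x" "lookup m c"] by (auto split: if_splits)
  with m show "total_degree s + d c = total_degree t + D"
    by (auto simp: FH_iff in_keys_iff total_degree_add simp del: sum.distrib)
qed

lemma hcomp_linear_extension: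
  assumes m: "m \<in> free_mod B'" and \<phi>: "\<And>c. c \<in> B' \<Longrightarrow> \<phi> c \<in> FH B d (d' c)"
  shows "hcomp d D (linear_extension smul \<phi> m) = linear_extension smul \<phi> (hcomp d' D m)"
proof -
  have "hcomp d D (linear_extension smul \<phi> (single c (single t x)))
      = linear_extension smul \<phi> (hcomp d' D (single c (single t x)))" if "c \<in> B'" for c t x
  proof -
    have "single c (single t x) \<in> FH B' d' (total_degree t + d' c)"
      using that by (auto simp: FH_iff free_mod_def lookup_single when_def)
    from hcomp_FH[OF this] hcomp_FH[OF monomial_smul_FH[OF \<phi>[OF that]]] show ?thesis
      by simp
  qed
  then show ?thesis
    using m
    by (subst (1 2) term_decomposition[of m])
       (auto simp: hcomp_sum free.linear_extension_sum free_mod_def intro!: sum.cong)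
qed

definition graded_submodule where
  "graded_submodule B d M \<longleftrightarrow> M \<subseteq> free_mod B \<and> free.subspace M \<and> (\<forall>m\<in>M. \<forall>D. hcomp d D m \<in> M)"

lemma graded_submodule_kernel:
  assumes "\<And>c. c \<in> B' \<Longrightarrow> \<phi> c \<in> FH B d (d' c)"
  shows "graded_submodule B' d' {m \<in> free_mod B'. linear_extension smul \<phi> m = 0}"
  unfolding graded_submodule_def
proof (intro conjI ballI allI)
  show "free.subspace {m \<in> free_mod B'. linear_extension smul \<phi> m = 0}"
    using subspace_free_mod[of B'] unfolding free.subspace_def
    by (auto simp: free.linear_extension_add free.linear_extension_smul)
  fix m D assume "m \<in> {m \<in> free_mod B'. linear_extension smul \<phi> m = 0}"
  then have m: "m \<in> free_mod B'" "linear_extension smul \<phi> m = 0" by auto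
  have "hcomp d D (linear_extension smul \<phi> m) = linear_extension smul \<phi> (hcomp d' D m)"
    using m(1) assms by (rule hcomp_linear_extension)
  with m show "hcomp d' D m \<in> {m \<in> free_mod B'. linear_extension smul \<phi> m = 0}"
    by (simp add: hcomp_free_mod)
qed auto


section \<open>Minimal generators of graded submodules\<close>

definition kscale :: "'k::field \<Rightarrow> (nat \<Rightarrow>\<^sub>0 ('v, 'k) mpoly) \<Rightarrow> (nat \<Rightarrow>\<^sub>0 ('v, 'k) mpoly)" where
  "kscale x m = smul (single 0 x) m"

interpretation kvs: vector_space kscale
  by standard
     (simp_all add: kscale_def free.scale_right_distrib free.scale_left_distrib single_add mult_single)

lemma hcomp_kscale: "hcomp d D (kscale x m) = kscale x (hcomp d D m)"
proof (rule free_eqI)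
  fix c t
  have "lookup (single 0 x * p) t = x * lookup p t" for p :: "('a, 'b) mpoly"
    using lookup_monomial_times[of 0 x p t] by simp
  then show "lookup (lookup (hcomp d D (kscale x m)) c) t = lookup (lookup (kscale x (hcomp d D m)) c) t"
    by (simp add: kscale_def lookup_hcomp mult_when)
qed

lemma finite_bounded_monomials: "finite {t :: 'v::finite \<Rightarrow>\<^sub>0 nat. total_degree t \<le> D}"
proof (rule finite_imageD)
  have "lookup t v \<le> D" if "total_degree t \<le> D" for t :: "'v \<Rightarrow>\<^sub>0 nat" and v
    using member_le_sum[of v UNIV "lookup t"] that by simp
  then have "lookup ` {t :: 'v \<Rightarrow>\<^sub>0 nat. total_degree t \<le> D} \<subseteq> (\<Pi>\<^sub>E v\<in>UNIV. {..D})"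
    by auto
  then show "finite (lookup ` {t :: 'v \<Rightarrow>\<^sub>0 nat. total_degree t \<le> D})"
    by (rule finite_subset) (simp add: finite_PiE)
  show "inj_on lookup {t :: 'v \<Rightarrow>\<^sub>0 nat. total_degree t \<le> D}"
    by (rule inj_onI) simp
qed

lemma FH_finite_dimensional:
  assumes fin: "\<And>D. finite {c \<in> B. d c = D}"
  shows "\<exists>T. finite T \<and> (FH B d D :: (nat \<Rightarrow>\<^sub>0 ('v::finite, 'k::field) mpoly) set) \<subseteq> kvs.span T"
proof -
  let ?C = "{c \<in> B. d c \<le> D}" and ?M = "{t :: 'v \<Rightarrow>\<^sub>0 nat. total_degree t \<le> D}"
  let ?T = "(\<lambda>(c, t). single c (single t 1) :: nat \<Rightarrow>\<^sub>0 ('v, 'k) mpoly) ` (?C \<times> ?M)"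
  have "?C = (\<Union>D'\<in>{..D}. {c \<in> B. d c = D'})" by auto
  then have "finite ?C" by (simp add: fin)
  then have "finite ?T" using finite_bounded_monomials by blast
  moreover have "m \<in> kvs.span ?T" if m: "m \<in> FH B d D" for m
  proof -
    have "single c (single t (lookup (lookup m c) t)) \<in> kvs.span ?T"
      if "c \<in> keys m" "t \<in> keys (lookup m c)" for c t
    proof -
      have "total_degree t + d c = D" "c \<in> B"
        using that m by (auto simp: FH_iff in_keys_iff free_mod_def)
      then have "single c (single t 1) \<in> ?T" by force
      then have "kscale (lookup (lookup m c) t) (single c (single t 1)) \<in> kvs.span ?T"
        by (intro kvs.span_scale kvs.span_base)
      then show ?thesis by (simp add: kscale_def mult_single)
    qed
    then show ?thesis
      by (subst term_decomposition[of m]) (intro kvs.span_sum)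
  qed
  ultimately show ?thesis by blast
qed

text \<open>Let \<open>V\<close> be the set of products of a variable with a homogeneous element of \<open>M\<close>; it spans
  \<open>\<mm>M\<close> over the field. A basis \<open>W \<subseteq> V\<close> of this span extends to a basis \<open>S\<close> of \<open>M\<close> of homogeneous
  elements, and the generators are \<open>G = S - W\<close>. They generate \<open>M\<close> by induction on the degree
  (Nakayama's lemma for graded modules), since an element of \<open>W\<close> is a variable times an element of
  smaller degree. They are minimal because in a relation the part with constant coefficients lies in
  the span of \<open>W\<close>, and \<open>G\<close> is linearly independent modulo this span.\<close>

lemma minimal_homogeneous_generators:
  fixes M :: "(nat \<Rightarrow>\<^sub>0 ('v::finite, 'k::field) mpoly) set"
  assumes fin: "\<And>D. finite {c \<in> B. d c = D}" and M: "graded_submodule B d M"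
  obtains G where "G \<subseteq> (\<Union>D. M \<inter> FH B d D)" "\<And>D. finite (G \<inter> FH B d D)" "M \<subseteq> free.span G"
    "\<And>X p g. finite X \<Longrightarrow> X \<subseteq> G \<Longrightarrow> (\<Sum>g\<in>X. smul (p g) g) = 0 \<Longrightarrow> g \<in> X \<Longrightarrow> lookup (p g) 0 = 0"
proof -
  have Mfree: "M \<subseteq> free_mod B" and Msub: "free.subspace M"
    and Mcomp: "\<And>m D. m \<in> M \<Longrightarrow> hcomp d D m \<in> M"
    using M by (auto simp: graded_submodule_def)
  define H where "H = (\<Union>D. M \<inter> FH B d D)"
  define V where "V = {smul (var v) h | v h. h \<in> H}"
  have monoH: "smul (single t x) h \<in> H" if "h \<in> H" for t x h
  proof -
    from that obtain D where h: "h \<in> M" "h \<in> FH B d D" by (auto simp: H_def)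
    from free.subspace_scale[OF Msub h(1), of "single t x"] monomial_smul_FH[OF h(2), of t x]
    show ?thesis unfolding H_def by blast
  qed
  have VH: "V \<subseteq> H" by (auto simp: V_def var_def intro: monoH)
  obtain W where W: "W \<subseteq> V" "kvs.independent W" "V \<subseteq> kvs.span W"
    using kvs.maximal_independent_subset[of V] by blast
  obtain S where S: "W \<subseteq> S" "S \<subseteq> H" "kvs.independent S" "H \<subseteq> kvs.span S"
    using kvs.maximal_independent_subset_extend[of W H] W VH by blast
  define G where "G = S - W"
  have GH: "G \<subseteq> H" using S by (auto simp: G_def)
  have finG: "finite (G \<inter> FH B d D)" for D
  proof -
    obtain T where T: "finite T" "(FH B d D :: (nat \<Rightarrow>\<^sub>0 ('v, 'k) mpoly) set) \<subseteq> kvs.span T"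
      using FH_finite_dimensional[OF fin] by blast
    have "kvs.independent (G \<inter> FH B d D)"
      by (rule kvs.independent_mono[OF S(3)]) (auto simp: G_def)
    with T show ?thesis using kvs.independent_span_bound[of T] by blast
  qed
  have homgen: "h \<in> free.span G" if "h \<in> M \<inter> FH B d D" for h D
    using that
  proof (induction D arbitrary: h rule: less_induct)
    case (less D)
    have basis: "hcomp d D x \<in> free.span G" if x: "x \<in> S" for x
    proof (cases "x \<in> W")
      case True
      then obtain v h' D' where x: "x = smul (var v) h'" "h' \<in> M" "h' \<in> FH B d D'"
        using W(1) by (auto simp: V_def H_def)
      then have "x \<in> FH B d (Suc D')"
        using monomial_smul_FH[of h' B d D' "single v 1" 1] by (simp add: var_def)
      from hcomp_FH[OF this, of D] less.IH[of D' h'] x show ?thesis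
        by (auto intro: free.span_scale free.span_zero)
    next
      case False
      then obtain D' where "x \<in> G" "x \<in> FH B d D'" using x GH by (auto simp: G_def H_def)
      with hcomp_FH[OF this(2), of D] show ?thesis
        by (auto intro: free.span_base free.span_zero)
    qed
    have "h \<in> kvs.span S" using less.prems S(4) by (auto simp: H_def)
    then have "hcomp d D h \<in> free.span G"
    proof (induction rule: kvs.span_induct_alt)
      case base then show ?case by (simp add: free.span_zero)
    next
      case (step c x y)
      then have "smul (single 0 c) (hcomp d D x) + hcomp d D y \<in> free.span G"
        by (intro free.span_add free.span_scale) (simp_all add: basis)
      also have "smul (single 0 c) (hcomp d D x) + hcomp d D y = hcomp d D (kscale c x + y)"
        by (simp only: hcomp_add hcomp_kscale kscale_def[of c "hcomp d D x"])
      finally show ?case .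
    qed
    then show ?case using less.prems hcomp_FH[of h B d D D] by simp
  qed
  have gen: "M \<subseteq> free.span G"
  proof
    fix m assume m: "m \<in> M"
    have "hcomp d D m \<in> free.span G" for D
      using m Mcomp Mfree hcomp_in_FH[of m B d D] by (intro homgen[of _ D]) auto
    then show "m \<in> free.span G"
      using sum_hcomp[of m d] free.span_sum by metis
  qed
  have min: "lookup (p g0) 0 = 0"
    if X: "finite X" "X \<subseteq> G" "(\<Sum>g\<in>X. smul (p g) g) = 0" "g0 \<in> X" for X p g0
  proof -
    let ?c = "\<lambda>g. lookup (p g) 0"
    have rest: "smul (p g - single 0 (?c g)) g \<in> kvs.span W" if g: "g \<in> X" for g
    proof -
      let ?q = "p g - single 0 (?c g)"
      have mono: "smul (single t (lookup ?q t)) g \<in> kvs.span W" if t: "t \<in> keys ?q" for t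
      proof -
        have "t \<noteq> 0" using t by (auto simp: in_keys_iff lookup_minus)
        then obtain v where "lookup t v \<noteq> 0" by (metis lookup_zero poly_mapping_eqI)
        then have t': "t = single v 1 + (t - single v 1)"
          by (intro poly_mapping_eqI) (auto simp: lookup_add lookup_minus lookup_single when_def)
        have e: "single t y = single 0 y * (var v * single (t - single v 1) 1)" for y :: 'k
          by (subst t') (simp add: var_def mult_single del: One_nat_def)
        have "smul (single (t - single v 1) 1) g \<in> H"
          using GH X(2) g by (intro monoH) auto
        then have "smul (var v) (smul (single (t - single v 1) 1) g) \<in> V"
          unfolding V_def by blast
        then have "smul (var v) (smul (single (t - single v 1) 1) g) \<in> kvs.span W"
          using W(3) by blast
        then have "kscale (lookup ?q t) (smul (var v) (smul (single (t - single v 1) 1) g)) \<in> kvs.span W"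
          by (rule kvs.span_scale)
        then show ?thesis
          unfolding e by (simp add: kscale_def mult.assoc)
      qed
      have "smul ?q g = smul (\<Sum>t\<in>keys ?q. single t (lookup ?q t)) g"
        by (simp only: poly_mapping_sum_monomials)
      also have "\<dots> = (\<Sum>t\<in>keys ?q. smul (single t (lookup ?q t)) g)"
        by (rule free.scale_sum_left)
      finally show ?thesis using mono by (simp only: kvs.span_sum)
    qed
    have "(\<Sum>g\<in>X. kscale (?c g) g) = - (\<Sum>g\<in>X. smul (p g - single 0 (?c g)) g)"
      using X(3) by (simp add: kscale_def free.scale_left_diff_distrib sum_subtractf)
    then have inW: "(\<Sum>g\<in>X. kscale (?c g) g) \<in> kvs.span W"
      using rest by (simp only: kvs.span_neg kvs.span_sum)
    show ?thesis
    proof (rule ccontr)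
      assume nz: "?c g0 \<noteq> 0"
      have g0: "g0 \<in> S" "g0 \<notin> W" using X by (auto simp: G_def)
      have "kscale (?c g0) g0 = (\<Sum>g\<in>X. kscale (?c g) g) - (\<Sum>g\<in>X - {g0}. kscale (?c g) g)"
        using X(1,4) by (simp add: sum.remove)
      also have "\<dots> \<in> kvs.span (S - {g0})"
      proof (rule kvs.span_diff)
        show "(\<Sum>g\<in>X. kscale (?c g) g) \<in> kvs.span (S - {g0})"
          using inW kvs.span_mono[of W "S - {g0}"] S(1) g0 by blast
        show "(\<Sum>g\<in>X - {g0}. kscale (?c g) g) \<in> kvs.span (S - {g0})"
          using X(2) by (intro kvs.span_sum kvs.span_scale kvs.span_base) (auto simp: G_def)
      qed
      finally have "kscale (inverse (?c g0)) (kscale (?c g0) g0) \<in> kvs.span (S - {g0})"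
        by (rule kvs.span_scale)
      then have "g0 \<in> kvs.span (S - {g0})" using nz by simp
      with S(3) g0 show False by (auto simp: kvs.dependent_def)
    qed
  qed
  show thesis
    using that[of G] GH finG gen min unfolding H_def by blast
qed


section \<open>Existence of minimal graded free resolutions\<close>

text \<open>The minimal generators are countable, as only finitely many have any given degree, and so they
  can be indexed by natural numbers. Finiteness in each degree passes to the new basis, which
  allows the construction to be iterated.\<close>

lemma minimal_cover:
  fixes M :: "(nat \<Rightarrow>\<^sub>0 ('v::finite, 'k::field) mpoly) set"
  assumes fin: "\<And>D. finite {c \<in> B. d c = D}" and M: "graded_submodule B d M"
  shows "\<exists>B' d' \<phi>. (\<forall>D. finite {c \<in> B'. d' c = D}) \<and> (\<forall>c\<in>B'. \<phi> c \<in> FH B d (d' c)) \<and>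
    linear_extension smul \<phi> ` free_mod B' = M \<and>
    (\<forall>m\<in>free_mod B'. linear_extension smul \<phi> m = 0 \<longrightarrow> (\<forall>c. lookup (lookup m c) 0 = 0))"
proof (rule minimal_homogeneous_generators[OF fin M])
  fix G
  assume G: "G \<subseteq> (\<Union>D. M \<inter> FH B d D)" "\<And>D. finite (G \<inter> FH B d D)" "M \<subseteq> free.span G"
    "\<And>X p g. finite X \<Longrightarrow> X \<subseteq> G \<Longrightarrow> (\<Sum>g\<in>X. smul (p g) g) = 0 \<Longrightarrow> g \<in> X \<Longrightarrow> lookup (p g) 0 = 0"
  have Msub: "free.subspace M" using M by (simp add: graded_submodule_def)
  have "countable (\<Union>D. G \<inter> FH B d D)" by (intro countable_UN countableI_type countable_finite G(2))
  moreover have "G = (\<Union>D. G \<inter> FH B d D)" using G(1) by blast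
  ultimately have cG: "countable G" by metis
  define B' where "B' = to_nat_on G ` G"
  define \<phi> where "\<phi> = from_nat_into G"
  define d' where "d' c = (SOME D. \<phi> c \<in> FH B d D)" for c
  have \<phi>_inv: "\<phi> (to_nat_on G g) = g" if "g \<in> G" for g
    using cG that by (simp add: \<phi>_def)
  have \<phi>G: "\<phi> c \<in> G" if "c \<in> B'" for c using that \<phi>_inv by (auto simp: B'_def)
  have inj: "inj_on \<phi> B'" by (rule inj_onI) (auto simp: B'_def \<phi>_inv)
  have \<phi>d: "\<phi> c \<in> FH B d (d' c)" if "c \<in> B'" for c
    unfolding d'_def by (rule someI_ex) (use \<phi>G[OF that] G(1) in blast)
  have "finite {c \<in> B'. d' c = D}" for D
  proof (rule finite_imageD)
    have "\<phi> ` {c \<in> B'. d' c = D} \<subseteq> G \<inter> FH B d D" using \<phi>G \<phi>d by auto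
    then show "finite (\<phi> ` {c \<in> B'. d' c = D})" using G(2) finite_subset by blast
    show "inj_on \<phi> {c \<in> B'. d' c = D}" using inj by (rule inj_on_subset) auto
  qed
  moreover have "linear_extension smul \<phi> ` free_mod B' = M"
  proof
    have "linear_extension smul \<phi> m \<in> M" if "m \<in> free_mod B'" for m
      using that \<phi>G G(1) by (intro free.linear_extension_mem[OF Msub]) (auto simp: free_mod_def)
    then show "linear_extension smul \<phi> ` free_mod B' \<subseteq> M" by blast
    have "free.subspace (linear_extension smul \<phi> ` free_mod B')"
      unfolding free.subspace_def
    proof (intro conjI ballI allI)
      show "0 \<in> linear_extension smul \<phi> ` free_mod B'"
        by (rule image_eqI[of _ _ 0]) (auto simp: free_mod_def)
      show "x + y \<in> linear_extension smul \<phi> ` free_mod B'"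
        if "x \<in> linear_extension smul \<phi> ` free_mod B'" "y \<in> linear_extension smul \<phi> ` free_mod B'" for x y
        using that free.subspace_add[OF subspace_free_mod]
        by (auto simp: free.linear_extension_add[symmetric] intro!: imageI)
      show "smul p x \<in> linear_extension smul \<phi> ` free_mod B'"
        if "x \<in> linear_extension smul \<phi> ` free_mod B'" for p x
        using that free.subspace_scale[OF subspace_free_mod]
        by (auto simp: free.linear_extension_smul[symmetric] intro!: imageI)
    qed
    moreover have "g \<in> linear_extension smul \<phi> ` free_mod B'" if "g \<in> G" for g
      by (rule image_eqI[of _ _ "single (to_nat_on G g) 1"])
         (use that \<phi>_inv in \<open>auto simp: free_mod_def B'_def\<close>)
    ultimately show "M \<subseteq> linear_extension smul \<phi> ` free_mod B'"
      using G(3) free.span_minimal by blast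
  qed
  moreover have "lookup (lookup m c) 0 = 0"
    if m: "m \<in> free_mod B'" "linear_extension smul \<phi> m = 0" for m c
  proof (cases "c \<in> keys m")
    case True
    have km: "keys m \<subseteq> B'" using m by (simp add: free_mod_def)
    have inv: "inv_into B' \<phi> (\<phi> e) = e" if "e \<in> keys m" for e
      using that km inj by (simp add: inv_into_f_f subset_iff)
    have "inj_on \<phi> (keys m)" using inj km by (rule inj_on_subset)
    then have "(\<Sum>g\<in>\<phi> ` keys m. smul (lookup m (inv_into B' \<phi> g)) g) = linear_extension smul \<phi> m"
      by (simp add: sum.reindex linear_extension_def inv)
    with m(2) have "(\<Sum>g\<in>\<phi> ` keys m. smul (lookup m (inv_into B' \<phi> g)) g) = 0" by simp
    from G(4)[OF _ _ this, of "\<phi> c"] True km \<phi>G have "lookup (lookup m (inv_into B' \<phi> (\<phi> c))) 0 = 0"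
      by auto
    then show ?thesis by (simp add: inv[OF True])
  qed (simp add: not_in_keys_iff_lookup_eq_zero)
  ultimately show ?thesis using \<phi>d by blast
qed

text \<open>Iterate minimal covers, starting with the ideal as a submodule of \<open>S\<close>: the next module to be covered is
  the kernel of the last cover. By minimality of the cover it has no elements with a
  constant term in some coordinate, so that the image of the next map lies in \<open>\<mm>F\<^sub>i\<close>.\<close>

lemma minimal_graded_free_resolution_exists:
  fixes A :: "('v::finite, 'k::field) mpoly set"
  assumes hom: "\<And>p. p \<in> A \<Longrightarrow> \<exists>D. p \<in> homogeneous D" and const: "\<And>p. p \<in> A \<Longrightarrow> lookup p 0 = 0"
  shows "\<exists>B d \<phi>. minimal_graded_free_resolution (ideal_span A) B d \<phi>"
proof -
  let ?I = "ideal_span A"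
  define M0 :: "(nat \<Rightarrow>\<^sub>0 ('v, 'k) mpoly) set" where "M0 = {m \<in> free_mod {0}. lookup m 0 \<in> ?I}"
  \<comment> \<open>A state \<open>(B, d, M)\<close> consists of the basis and degrees of \<open>F\<^sub>i\<close> and of the submodule \<open>M\<close> that is to
    be the image of the map from \<open>F\<^sub>i\<^sub>+\<^sub>1\<close>.\<close>
  define P where "P i s \<longleftrightarrow> (case s of (B, d, M) \<Rightarrow> (\<forall>D. finite {c \<in> B. d c = D}) \<and>
      graded_submodule B d M \<and> (\<forall>m\<in>M. \<forall>c. lookup (lookup m c) 0 = 0) \<and>
      (i = 0 \<longrightarrow> B = {0} \<and> d 0 = 0 \<and> M = M0))"
    for i :: nat and s :: "nat set \<times> (nat \<Rightarrow> nat) \<times> (nat \<Rightarrow>\<^sub>0 ('v, 'k) mpoly) set"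
  define R where "R s s' \<longleftrightarrow> (case s of (B, d, M) \<Rightarrow> case s' of (B', d', M') \<Rightarrow>
      \<exists>\<phi>. (\<forall>c\<in>B'. \<phi> c \<in> FH B d (d' c)) \<and> linear_extension smul \<phi> ` free_mod B' = M \<and>
      M' = {m \<in> free_mod B'. linear_extension smul \<phi> m = 0})"
    for s s' :: "nat set \<times> (nat \<Rightarrow> nat) \<times> (nat \<Rightarrow>\<^sub>0 ('v, 'k) mpoly) set"
  have M0_lookup: "lookup m c = 0" if "m \<in> M0" "c \<noteq> 0" for m c
    using that by (auto simp: M0_def free_mod_def not_in_keys_iff_lookup_eq_zero[symmetric])
  have "graded_submodule {0} (\<lambda>_. 0) M0"
    unfolding graded_submodule_def
  proof (intro conjI ballI allI)
    show sub: "free.subspace M0"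
      using subspace_free_mod[of "{0}"] unfolding free.subspace_def
      by (auto simp: M0_def lookup_add ideal_span_0 ideal_span_add ideal_span_times)
    have "hcomp (\<lambda>_. 0) D (single 0 p) \<in> M0" if "p \<in> ?I" for p D
      using that
    proof (induction rule: ideal_span_induct)
      case zero show ?case by (simp add: M0_def free_mod_def ideal_span_0)
    next
      case (add c p y)
      obtain D' where D': "p \<in> homogeneous D'" using hom add by blast
      have t: "hcomp (\<lambda>_. 0) D (single 0 (single t x * p)) \<in> M0" for t x
      proof -
        have "single 0 (single t x * p) \<in> FH {0} (\<lambda>_. 0) (total_degree t + D')"
          using homogeneous_times[OF homogeneous_monomial D']
          by (auto simp: free_mod_homogeneous_def free_mod_def)
        from hcomp_FH[OF this] show ?thesis
          using add by (auto simp: M0_def free_mod_def ideal_span_0 ideal_span_base ideal_span_times)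
      qed
      have "single (0 :: nat) (c * p) = (\<Sum>t\<in>keys c. single 0 (single t (lookup c t) * p))"
      proof -
        have "c * p = (\<Sum>t\<in>keys c. single t (lookup c t) * p)"
          by (simp add: poly_mapping_sum_monomials sum_distrib_right[symmetric])
        also have "single 0 \<dots> = (\<Sum>t\<in>keys c. single 0 (single t (lookup c t) * p))"
          by (rule sum_comp_morphism[unfolded comp_def, symmetric]) (simp_all add: single_add)
        finally show ?thesis .
      qed
      then have "hcomp (\<lambda>_. 0) D (single 0 (c * p)) =
          (\<Sum>t\<in>keys c. hcomp (\<lambda>_. 0) D (single 0 (single t (lookup c t) * p)))"
        by (simp only: hcomp_sum)
      also have "\<dots> \<in> M0" by (intro free.subspace_sum[OF sub] t)
      finally have "hcomp (\<lambda>_. 0) D (single 0 (c * p)) + hcomp (\<lambda>_. 0) D (single 0 y) \<in> M0"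
        using add.IH by (rule free.subspace_add[OF sub])
      then show ?case by (simp add: single_add hcomp_add)
    qed
    moreover have "m = single 0 (lookup m 0)" if "m \<in> M0" for m
      by (rule poly_mapping_eqI, rename_tac c, case_tac "c = 0")
         (simp_all add: lookup_single M0_lookup[OF that])
    ultimately show "hcomp (\<lambda>_. 0) D m \<in> M0" if "m \<in> M0" for m D
      using that by (metis (mono_tags, lifting) M0_def mem_Collect_eq)
  qed (auto simp: M0_def)
  moreover have "lookup (lookup m c) 0 = 0" if "m \<in> M0" for m c
  proof -
    have "lookup p 0 = 0" if "p \<in> ?I" for p
      using that by (induction rule: ideal_span_induct) (simp_all add: lookup_add lookup_times_zero const)
    then show ?thesis using that M0_lookup[OF that, of c] by (cases "c = 0") (auto simp: M0_def)
  qed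
  ultimately have "\<exists>s. P 0 s"
    by (intro exI[of _ "({0}, (\<lambda>_. 0), M0)"]) (simp add: P_def)
  moreover have "\<exists>s'. P (Suc i) s' \<and> R s s'" if s: "P i s" for i s
  proof -
    obtain B d M where s_eq: "s = (B, d, M)" by (cases s)
    from s have fin: "\<And>D. finite {c \<in> B. d c = D}" and M: "graded_submodule B d M"
      by (auto simp: P_def s_eq)
    from minimal_cover[OF fin M] obtain B' d' \<phi> where
      *: "(\<forall>D. finite {c \<in> B'. d' c = D}) \<and> (\<forall>c\<in>B'. \<phi> c \<in> FH B d (d' c)) \<and>
        linear_extension smul \<phi> ` free_mod B' = M \<and>
        (\<forall>m\<in>free_mod B'. linear_extension smul \<phi> m = 0 \<longrightarrow> (\<forall>c. lookup (lookup m c) 0 = 0))"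
      by (elim exE)
    define s' where "s' = (B', d', {m \<in> free_mod B'. linear_extension smul \<phi> m = 0})"
    have "P (Suc i) s'"
      using * graded_submodule_kernel[of B' \<phi> B d d'] by (simp add: P_def s'_def)
    moreover have "R s s'"
      unfolding R_def s'_def s_eq prod.case using * by (intro exI[of _ \<phi>]) simp
    ultimately show ?thesis by blast
  qed
  ultimately obtain s where s: "\<And>i. P i (s i)" "\<And>i. R (s i) (s (Suc i))"
    using dependent_nat_choice[of P "\<lambda>_. R"] by metis
  define B where "B i = fst (s i)" for i
  define d where "d i = fst (snd (s i))" for i
  define M where "M i = snd (snd (s i))" for i
  have s_eq: "s i = (B i, d i, M i)" for i by (simp add: B_def d_def M_def)
  have "\<exists>\<phi>. (\<forall>c\<in>B (Suc i). \<phi> c \<in> FH (B i) (d i) (d (Suc i) c)) \<and>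
      linear_extension smul \<phi> ` free_mod (B (Suc i)) = M i \<and>
      M (Suc i) = {m \<in> free_mod (B (Suc i)). linear_extension smul \<phi> m = 0}" for i
    using s(2)[of i] unfolding R_def s_eq prod.case .
  then obtain \<phi> where *: "\<And>i. (\<forall>c\<in>B (Suc i). \<phi> i c \<in> FH (B i) (d i) (d (Suc i) c)) \<and>
      linear_extension smul (\<phi> i) ` free_mod (B (Suc i)) = M i \<and>
      M (Suc i) = {m \<in> free_mod (B (Suc i)). linear_extension smul (\<phi> i) m = 0}"
    by (rule that[OF someI_ex])
  have \<phi>: "\<And>i c. c \<in> B (Suc i) \<Longrightarrow> \<phi> i c \<in> FH (B i) (d i) (d (Suc i) c)"
      "\<And>i. linear_extension smul (\<phi> i) ` free_mod (B (Suc i)) = M i"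
      "\<And>i. M (Suc i) = {m \<in> free_mod (B (Suc i)). linear_extension smul (\<phi> i) m = 0}"
    using * by simp_all
  have "lookup (lookup (\<phi> i c) e) 0 = 0" if c: "c \<in> B (Suc i)" for i c e
  proof -
    have "\<phi> i c \<in> linear_extension smul (\<phi> i) ` free_mod (B (Suc i))"
      by (rule image_eqI[of _ _ "single c 1"]) (use c in \<open>auto simp: free_mod_def\<close>)
    then show ?thesis using s(1)[of i] unfolding \<phi>(2) P_def s_eq by auto
  qed
  moreover have "B 0 = {0}" "d 0 0 = 0" "M 0 = M0"
    using s(1)[of 0] unfolding P_def s_eq by auto
  ultimately have "minimal_graded_free_resolution ?I B d \<phi>"
    unfolding minimal_graded_free_resolution_def lin_ext_eq
    using \<phi> by (simp add: M0_def)
  then show ?thesis by blast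
qed


section \<open>The regularity of binomial edge ideals\<close>

text \<open>The pairs of variables are \<open>x\<^bsub>v\<^sub>i\<^esub>\<close>, \<open>y\<^bsub>u\<^sub>i\<^esub>\<close>. A monomial \<open>x\<^sub>p y\<^sub>q\<close> of a generator \<open>f\<^sub>p\<^sub>q\<close> survives only if
  \<open>p = v\<^sub>j\<close> and \<open>q = u\<^sub>i\<close>, and then \<open>i = j\<close> as \<open>{p, q}\<close> is an edge. Of the two monomials of
  \<open>f\<^bsub>v\<^sub>iu\<^sub>i\<^esub>\<close>, the second one, \<open>x\<^bsub>u\<^sub>i\<^esub> y\<^bsub>v\<^sub>i\<^esub>\<close>, is killed because no \<open>u\<^sub>i\<close> is some \<open>v\<^sub>j\<close>.\<close>

lemma matching_le_regularity:
  fixes E :: "'n::{finite,linorder} set set" and v u :: "nat \<Rightarrow> 'n"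
  assumes E: "simple_graph E" and v: "inj_on v {..<k}"
    and u: "\<And>i. i < k \<Longrightarrow> u i \<in> nbrs E (v i)"
    and sep: "\<And>i j. i < k \<Longrightarrow> j < k \<Longrightarrow> i \<noteq> j \<Longrightarrow> u i \<notin> closed_nbrs E (v j)"
  shows "ereal (real k) \<le> regularity_quotient (binomial_edge_ideal E :: ('n + 'n, 'k::field) mpoly set)"
proof -
  let ?A = "{edge_binomial i j | i j. {i, j} \<in> E \<and> i < j} :: ('n + 'n, 'k) mpoly set"
  let ?x = "\<lambda>i. Inl (v i) :: 'n + 'n" and ?y = "\<lambda>i. Inr (u i) :: 'n + 'n"
  have u_nbr: "i = j" if "i < k" "j < k" "{v j, u i} \<in> E" for i j
    using sep[of i j] that by (auto simp: closed_nbrs_def nbrs_def)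
  have uv: "u i \<noteq> v j" if "i < k" "j < k" for i j
    using sep[of i j] u[of i] E that
    by (cases "i = j") (auto simp: closed_nbrs_def nbrs_def simple_graph_def)
  interpret variable_pairs k ?x ?y
  proof
    show "inj_on ?x {..<k}" using v by (auto simp: inj_on_def)
    show "inj_on ?y {..<k}"
    proof (rule inj_onI)
      fix i j assume "i \<in> {..<k}" "j \<in> {..<k}" "?y i = ?y j"
      then show "i = j" using u_nbr[of i j] u[of j] by (auto simp: nbrs_def)
    qed
  qed auto
  have edge_bad: "bad {..<k} (single (Inl p) 1 + single (Inr q) 1)" if pq: "{p, q} \<in> E" for p q
  proof -
    let ?m = "single (Inl p) 1 + single (Inr q) 1 :: 'n + 'n \<Rightarrow>\<^sub>0 nat"
    have keys: "Inl p \<in> keys ?m" "Inr q \<in> keys ?m"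
      by (simp_all add: in_keys_iff lookup_add)
    show ?thesis
    proof (cases "p \<in> v ` {..<k} \<and> q \<in> u ` {..<k}")
      case True
      then obtain i j where "i < k" "j < k" "p = v j" "q = u i" by auto
      moreover from this pq have "i = j" by (auto intro: u_nbr)
      ultimately show ?thesis using keys by (auto simp: bad_def)
    next
      case False
      then have "Inl p \<notin> ?x ` {..<k} \<union> ?y ` {..<k} \<or> Inr q \<notin> ?x ` {..<k} \<union> ?y ` {..<k}" by auto
      with keys show ?thesis unfolding bad_def by blast
    qed
  qed
  have edge_Q: "edge_binomial p q \<in> (Q {..<k} :: ('n + 'n, 'k) mpoly set)" if "{p, q} \<in> E" for p q
    unfolding edge_binomial_monomials using edge_bad[of p q] edge_bad[of q p] that
    by (intro Q_diff) (simp_all add: Q_def insert_commute)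
  have "\<exists>B d \<phi>. minimal_graded_free_resolution (ideal_span ?A) B d \<phi>"
  proof (rule minimal_graded_free_resolution_exists)
    fix p assume p: "p \<in> ?A"
    then show "\<exists>D. p \<in> homogeneous D" using edge_binomial_homogeneous by blast
    have "p \<in> Q {..<k}" using p edge_Q by blast
    then show "lookup p 0 = 0" by (rule lookup_0_Q)
  qed
  then obtain B d \<phi> where res: "minimal_graded_free_resolution
      (binomial_edge_ideal E :: ('n + 'n, 'k) mpoly set) B d \<phi>"
    unfolding binomial_edge_ideal_def by blast
  have "\<exists>c\<in>B k. d k c = 2 * k"
  proof (rule resolution_has_generator[OF res])
    fix i assume i: "i < k"
    then show "edge_binomial (v i) (u i) \<in> (binomial_edge_ideal E :: ('n + 'n, 'k) mpoly set)"
      using u[OF i] by (intro edge_binomial_in_binomial_edge_ideal) (simp add: nbrs_def)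
    have "Inl (u i) \<notin> ?x ` {..<k} \<union> ?y ` {..<k}" using uv[OF i] by auto
    moreover have "Inl (u i) \<in> keys (single (Inl (u i)) 1 + single (Inr (v i)) 1 :: 'n + 'n \<Rightarrow>\<^sub>0 nat)"
      by (simp add: in_keys_iff lookup_add)
    ultimately have "bad {} (single (Inl (u i)) 1 + single (Inr (v i)) 1)"
      unfolding bad_def by blast
    then have "0 - single (single (Inl (u i)) 1 + single (Inr (v i)) 1) 1 \<in> (Q {} :: ('n + 'n, 'k) mpoly set)"
      by (intro Q_diff Q_0) (simp add: Q_def)
    then show "edge_binomial (v i) (u i) - z i \<in> (Q {} :: ('n + 'n, 'k) mpoly set)"
      by (simp add: edge_binomial_monomials)
  next
    show "(binomial_edge_ideal E :: ('n + 'n, 'k) mpoly set) \<subseteq> Q {..<k}"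
      unfolding binomial_edge_ideal_def ideal_span_def
      by (rule module.span_minimal[OF module_times _ subspace_Q]) (auto intro: edge_Q)
  qed
  then have "\<exists>B d \<phi>. minimal_graded_free_resolution
      (binomial_edge_ideal E :: ('n + 'n, 'k) mpoly set) B d \<phi> \<and> (\<exists>c\<in>B k. d k c = 2 * k)"
    using res by blast
  then have "ereal (real (2 * k) - real k)
      \<le> regularity_quotient (binomial_edge_ideal E :: ('n + 'n, 'k) mpoly set)"
    unfolding regularity_quotient_def by (intro Sup_upper) blast
  then show ?thesis by simp
qed

theorem theorem4p6:
  fixes E :: "'n::{finite,linorder} set set"
    and v :: "nat \<Rightarrow> 'n"
    and k :: nat
  assumes "simple_graph E"
    and "inj_on v {1..k}"
    and "minimal_completion_set E (v ` {1..k})"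
    and "\<forall>i\<in>{1..k}. \<exists>u \<in> nbrs E (v i). u \<notin> (\<Union>j\<in>{1..k} - {i}. closed_nbrs E (v j))"
  shows "local_v_number (binomial_edge_ideal E :: ('n + 'n, 'k::field) mpoly set) (P_empty E) \<le> enat k
    \<and> ereal (real k) \<le> regularity_quotient (binomial_edge_ideal E :: ('n + 'n, 'k) mpoly set)"
proof
  have "card (v ` {1..k}) = k" using assms(2) by (simp add: card_image)
  then show "local_v_number (binomial_edge_ideal E :: ('n + 'n, 'k) mpoly set) (P_empty E) \<le> enat k"
    using local_v_number_le_completion[of E "v ` {1..k}"] assms(3)
    by (simp add: minimal_completion_set_def)
  from assms(4) obtain u where
    u: "\<And>i. i \<in> {1..k} \<Longrightarrow> u i \<in> nbrs E (v i)"
       "\<And>i. i \<in> {1..k} \<Longrightarrow> u i \<notin> (\<Union>j\<in>{1..k} - {i}. closed_nbrs E (v j))"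
    by metis
  \<comment> \<open>The pairs are counted from \<open>0\<close> in the general bound, hence the shift by one.\<close>
  show "ereal (real k) \<le> regularity_quotient (binomial_edge_ideal E :: ('n + 'n, 'k) mpoly set)"
  proof (rule matching_le_regularity[where v = "\<lambda>i. v (Suc i)" and u = "\<lambda>i. u (Suc i)"])
    show "simple_graph E" by (rule assms(1))
    show "inj_on (\<lambda>i. v (Suc i)) {..<k}"
    proof (rule inj_onI)
      fix i j assume "i \<in> {..<k}" "j \<in> {..<k}" "v (Suc i) = v (Suc j)"
      then show "i = j" using inj_onD[OF assms(2), of "Suc i" "Suc j"] by simp
    qed
    show "u (Suc i) \<in> nbrs E (v (Suc i))" if "i < k" for i
      using that u(1) by simp
    show "u (Suc i) \<notin> closed_nbrs E (v (Suc j))" if "i < k" "j < k" "i \<noteq> j" for i j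
      using that u(2)[of "Suc i"] by auto
  qed
qed

end
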